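(* Let $X$ be a compact subset of a real normed vector space $(V,\|\cdot\|)$. For all $u,v\in\Delta(X)$, $$d_1(u,v)=d_2(u,v)=d_2^+(u,v)=d_3(u,v).$$
   Context: $E=\mathcal C(X)$ is the space of continuous real functions on $X$. $\Delta(X)$ is the set of Borel probability measures on $X$, and for $f\in E$ we write $u(f)=\int f\,du$. - $D_1=\{f\in E:\ \forall x,y\in X,\ \forall a,b\ge 0,\ af(x)-bf(y)\le\|ax-by\|\}$, and $d_1(u,v)=\sup_{f\in D_1}\big(u(f)-v(f)\big)$. - $D_2=\{(f,g)\in E\times E:\ \forall x,y\in X,\ \forall a,b\ge0,\ af(x)+bg(y)\le\|ax-by\|\}$, and $d_2(u,v)=\sup_{(f,g)\in D_2}\big(u(f)+v(g)\big)$. - For $\varepsilon>0$, $D_2^\varepsilon=\{(f,g)\in E\times E:\ \forall x,y\in X,\ \forall a,b\in[0,1],\ af(x)+bg(y)\le \varepsilon+\|ax-by\|\}$ and $d_2^\varepsilon(u,v)=\sup_{(f,g)\in D_2^\varepsilon}\big(u(f)+v(g)\big)$. Then $d_2^+(u,v)=\inf_{\varepsilon>0}d_2^\varepsilon(u,v)$. - $\mathcal M_3(u,v)$ is the set of finite positive Borel measures $\gamma$ on $X^2\times[0,1]^2$ such that for every $f\in E$: - $\int\lambda f(x)\,d\gamma(x,y,\lambda,\mu)=u(f)$, and - $\int\mu f(y)\,d\gamma(x,y,\lambda,\mu)=v(f)$. - $d_3(u,v)=\inf_{\gamma\in\mathcal M_3(u,v)}\int_{X^2\times[0,1]^2}\|\lambda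 x-\mu y\|\,d\gamma(x,y,\lambda,\mu)$. *)

theory Defs
  imports "HOL-Probability.Probability"
begin

definition Delta :: "'a::real_normed_vector set \<Rightarrow> 'a measure set" where
  "Delta X = {u. prob_space u \<and> sets u = sets (restrict_space borel X)}"

definition D1 :: "'a::real_normed_vector set \<Rightarrow> ('a \<Rightarrow> real) set" where
  "D1 X = {f. continuous_on X f \<and>
     (\<forall>x\<in>X. \<forall>y\<in>X. \<forall>a::real. \<forall>b::real. a \<ge> 0 \<longrightarrow> b \<ge> 0 \<longrightarrow>
        a * f x - b * f y \<le> norm (a *\<^sub>R x - b *\<^sub>R y))}"

definition d1 :: "'a::real_normed_vector set \<Rightarrow> 'a measure \<Rightarrow> 'a measure \<Rightarrow> real" where
  "d1 X u v = Sup ((\<lambda>f. integral\<^sup>L u f - integral\<^sup>L v f) ` D1 X)"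

definition D2 :: "'a::real_normed_vector set \<Rightarrow> (('a \<Rightarrow> real) \<times> ('a \<Rightarrow> real)) set" where
  "D2 X = {(f, g). continuous_on X f \<and> continuous_on X g \<and>
     (\<forall>x\<in>X. \<forall>y\<in>X. \<forall>a::real. \<forall>b::real. a \<ge> 0 \<longrightarrow> b \<ge> 0 \<longrightarrow>
        a * f x + b * g y \<le> norm (a *\<^sub>R x - b *\<^sub>R y))}"

definition d2 :: "'a::real_normed_vector set \<Rightarrow> 'a measure \<Rightarrow> 'a measure \<Rightarrow> real" where
  "d2 X u v = Sup ((\<lambda>(f, g). integral\<^sup>L u f + integral\<^sup>L v g) ` D2 X)"

definition D2eps :: "'a::real_normed_vector set \<Rightarrow> real \<Rightarrow> (('a \<Rightarrow> real) \<times> ('a \<Rightarrow> real)) set" where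
  "D2eps X \<epsilon> = {(f, g). continuous_on X f \<and> continuous_on X g \<and>
     (\<forall>x\<in>X. \<forall>y\<in>X. \<forall>a\<in>{0..1::real}. \<forall>b\<in>{0..1::real}.
        a * f x + b * g y \<le> \<epsilon> + norm (a *\<^sub>R x - b *\<^sub>R y))}"

definition d2eps :: "'a::real_normed_vector set \<Rightarrow> real \<Rightarrow> 'a measure \<Rightarrow> 'a measure \<Rightarrow> real" where
  "d2eps X \<epsilon> u v = Sup ((\<lambda>(f, g). integral\<^sup>L u f + integral\<^sup>L v g) ` D2eps X \<epsilon>)"

definition d2plus :: "'a::real_normed_vector set \<Rightarrow> 'a measure \<Rightarrow> 'a measure \<Rightarrow> real" where
  "d2plus X u v = Inf ((\<lambda>\<epsilon>. d2eps X \<epsilon> u v) ` {0<..})"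

definition M3 :: "'a::real_normed_vector set \<Rightarrow> 'a measure \<Rightarrow> 'a measure
                   \<Rightarrow> ('a \<times> 'a \<times> real \<times> real) measure set" where
  "M3 X u v = {\<gamma>. finite_measure \<gamma> \<and>
     sets \<gamma> = sets (restrict_space borel (X \<times> X \<times> {0..1} \<times> {0..1})) \<and>
     (\<forall>f. continuous_on X f \<longrightarrow>
        (\<integral>z. (case z of (x, y, l, m) \<Rightarrow> l * f x) \<partial>\<gamma>) = integral\<^sup>L u f \<and>
        (\<integral>z. (case z of (x, y, l, m) \<Rightarrow> m * f y) \<partial>\<gamma>) = integral\<^sup>L v f)}"

definition d3 :: "'a::real_normed_vector set \<Rightarrow> 'a measure \<Rightarrow> 'a measure \<Rightarrow> real" where
  "d3 X u v = Inf ((\<lambda>\<gamma>. \<integral>z. (case z of (x, y, l, m) \<Rightarrow> norm (l *\<^sub>R x - m *\<^sub>R y)) \<partial>\<gamma>)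
                   ` M3 X u v)"

end

theory Submission
  imports Defs
begin

text \<open>
  Weak duality gives \<open>d2plus \<le> d3\<close>, and \<open>d1 = d2\<close> because a pair \<open>(f, g)\<close> is dominated by
  \<open>(h, -h)\<close> for the positively homogeneous 1-Lipschitz function
  \<open>h y = sup (c f x - norm (c x - y))\<close>, the supremum being over \<open>c \<ge> 0\<close> and \<open>x\<close>.
  For \<open>d3 \<le> d1\<close> no infinite-dimensional duality is needed. Partition \<open>X\<close> into finitely many cells of
  small diameter and solve the transport problem between the discretised measures, where strong
  duality follows from finite-dimensional Hahn--Banach. The discrete potential extends to \<open>X\<close> by the
  formula for \<open>h\<close>, and the discrete plan lifts to a plan with the exact marginals \<open>u\<close> and \<open>v\<close> by
  spreading its mass over products of cells proportionally to the product measure of \<open>u\<close> and \<open>v\<close>. Both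
  operations change the value by at most a multiple of the diameter.
\<close>

section \<open>Sublinear functionals and finite-dimensional Hahn-Banach\<close>

text \<open>Positive homogeneity is asked only as an inequality, the form in which it passes to
  infima; \<open>sublinear_fun_scale\<close> recovers equality by rescaling with
  \<open>inverse c\<close>.\<close>

definition sublinear_fun :: "(('i \<Rightarrow> real) \<Rightarrow> real) \<Rightarrow> bool" where
  "sublinear_fun P \<longleftrightarrow> (\<forall>x y. P (\<lambda>i. x i + y i) \<le> P x + P y) \<and>
     (\<forall>c x. 0 \<le> c \<longrightarrow> P (\<lambda>i. c * x i) \<le> c * P x)"

lemma sublinear_fun_add: "sublinear_fun P \<Longrightarrow> P (\<lambda>i. x i + y i) \<le> P x + P y"
  by (simp add: sublinear_fun_def)

lemma sublinear_fun_scale_le: "sublinear_fun P \<Longrightarrow> 0 \<le> c \<Longrightarrow> P (\<lambda>i. c * x i) \<le> c * P x"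
  by (simp add: sublinear_fun_def)

lemma sublinear_fun_zero:
  assumes "sublinear_fun P" shows "P (\<lambda>i. 0) = 0"
  using sublinear_fun_add[OF assms, of "\<lambda>i. 0" "\<lambda>i. 0"]
    sublinear_fun_scale_le[OF assms, of 0 "\<lambda>i. 0"] by simp

lemma sublinear_fun_scale:
  assumes P: "sublinear_fun P" and c: "0 \<le> c"
  shows "P (\<lambda>i. c * x i) = c * P x"
proof (cases "c = 0")
  case True
  then show ?thesis using sublinear_fun_zero[OF P] by simp
next
  case False
  then have "P x \<le> inverse c * P (\<lambda>i. c * x i)"
    using sublinear_fun_scale_le[OF P, of "inverse c" "\<lambda>i. c * x i"] c
    by (simp add: field_simps)
  then have "c * P x \<le> P (\<lambda>i. c * x i)"
    using False c by (simp add: field_simps)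
  then show ?thesis
    using sublinear_fun_scale_le[OF P c, of x] by simp
qed

lemma sublinear_fun_sum:
  assumes P: "sublinear_fun P" and "finite K" and "\<And>k. k \<in> K \<Longrightarrow> 0 \<le> c k"
  shows "P (\<lambda>i. \<Sum>k\<in>K. c k * e k i) \<le> (\<Sum>k\<in>K. c k * P (e k))"
  using assms(2,3)
proof (induction K rule: finite_induct)
  case empty
  then show ?case using sublinear_fun_zero[OF P] by simp
next
  case (insert k K)
  have "P (\<lambda>i. c k * e k i + (\<Sum>k\<in>K. c k * e k i))
      \<le> P (\<lambda>i. c k * e k i) + P (\<lambda>i. \<Sum>k\<in>K. c k * e k i)"
    by (rule sublinear_fun_add[OF P])
  also have "\<dots> \<le> c k * P (e k) + (\<Sum>k\<in>K. c k * P (e k))"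
    using insert by (intro add_mono sublinear_fun_scale_le[OF P]) auto
  finally show ?case using insert by simp
qed

text \<open>Serves two families: a ray of real parameters in the Hahn-Banach step, and the transport
  plans in \<open>finite_duality\<close>. In both, the witness \<open>k\<close> is the sum or the
  multiple of the given parameters. The minorant \<open>L\<close> makes the real infima genuine
  lower bounds.\<close>

lemma sublinear_fun_INF:
  fixes V :: "'m \<Rightarrow> ('i \<Rightarrow> real) \<Rightarrow> real"
  assumes ne: "S \<noteq> {}"
    and lower: "\<And>m x. m \<in> S \<Longrightarrow> L x \<le> V m x"
    and add: "\<And>m n x y. m \<in> S \<Longrightarrow> n \<in> S \<Longrightarrow> \<exists>k\<in>S. V k (\<lambda>i. x i + y i) \<le> V m x + V n y"
    and scale: "\<And>m c x. m \<in> S \<Longrightarrow> 0 \<le> c \<Longrightarrow> \<exists>k\<in>S. V k (\<lambda>i. c * x i) \<le> c * V m x"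
  shows "sublinear_fun (\<lambda>x. INF m\<in>S. V m x)"
proof -
  define Q where "Q = (\<lambda>x. INF m\<in>S. V m x)"
  have bdd: "bdd_below ((\<lambda>m. V m x) ` S)" for x
    using lower by (auto intro!: bdd_belowI2[where m = "L x"])
  have Q_le: "Q x \<le> V m x" if "m \<in> S" for m x
    unfolding Q_def by (rule cINF_lower[OF bdd that])
  have Q_greatest: "z \<le> Q x" if "\<And>m. m \<in> S \<Longrightarrow> z \<le> V m x" for z x
    unfolding Q_def using ne that by (intro cINF_greatest) auto
  have "Q (\<lambda>i. x i + y i) \<le> Q x + Q y" for x y
  proof -
    have "Q (\<lambda>i. x i + y i) \<le> V n y + V m x" if "m \<in> S" "n \<in> S" for m n
      using add[OF that, of x y] Q_le[of _ "\<lambda>i. x i + y i"] by fastforce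
    then have le: "Q (\<lambda>i. x i + y i) - V m x \<le> Q y" if "m \<in> S" for m
      using that by (intro Q_greatest) (simp add: diff_le_eq)
    have "Q (\<lambda>i. x i + y i) - Q y \<le> Q x"
    proof (rule Q_greatest)
      fix m assume "m \<in> S"
      from le[OF this] show "Q (\<lambda>i. x i + y i) - Q y \<le> V m x" by simp
    qed
    then show ?thesis by simp
  qed
  moreover have "Q (\<lambda>i. c * x i) \<le> c * Q x" if c: "0 \<le> c" for c x
  proof -
    have le: "Q (\<lambda>i. c * x i) \<le> c * V m x" if m: "m \<in> S" for m
    proof -
      obtain k where "k \<in> S" "V k (\<lambda>i. c * x i) \<le> c * V m x" using scale[OF m c] by blast
      then show ?thesis using Q_le[of k "\<lambda>i. c * x i"] by simp
    qed
    show ?thesis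
    proof (cases "c = 0")
      case True
      then show ?thesis using le ne by auto
    next
      case False
      have "Q (\<lambda>i. c * x i) / c \<le> Q x"
        using False c le by (intro Q_greatest) (simp add: divide_le_eq mult.commute)
      then show ?thesis using False c by (simp add: divide_le_eq mult.commute)
    qed
  qed
  ultimately show ?thesis unfolding sublinear_fun_def Q_def by blast
qed

text \<open>The classical Hahn-Banach step: \<open>Q x\<close> is the infimum over t >= 0 of P (x +
  t w) - t P w. The parameter t = 0 gives Q <= P, and t = 1 at the point -w gives - P w.\<close>

lemma sublinear_fun_minorant_at:
  assumes P: "sublinear_fun P"
  obtains Q where "sublinear_fun Q" "\<And>x. Q x \<le> P x" "Q (\<lambda>i. - w i) \<le> - P w"
proof
  define V where "V = (\<lambda>t x. P (\<lambda>i. x i + t * w i) - t * P w)"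
  \<comment> \<open>Bounded below, because t P w = P (t w) <= P (x + t w) + P (- x).\<close>
  have lower: "- P (\<lambda>i. - x i) \<le> V t x" if "t \<in> {0..}" for t x
    using sublinear_fun_add[OF P, of "\<lambda>i. x i + t * w i" "\<lambda>i. - x i"]
      sublinear_fun_scale[OF P, of t w] that by (simp add: V_def)
  show "sublinear_fun (\<lambda>x. INF t\<in>{0..}. V t x)"
  proof (rule sublinear_fun_INF[where L = "\<lambda>x. - P (\<lambda>i. - x i)"])
    fix m n :: real and x y assume "m \<in> {0..}" "n \<in> {0..}"
    then show "\<exists>k\<in>{0..}. V k (\<lambda>i. x i + y i) \<le> V m x + V n y"
      using sublinear_fun_add[OF P, of "\<lambda>i. x i + m * w i" "\<lambda>i. y i + n * w i"]
      by (intro bexI[of _ "m + n"]) (auto simp: V_def algebra_simps)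
  next
    fix m c :: real and x assume "m \<in> {0..}" "0 \<le> c"
    then show "\<exists>k\<in>{0..}. V k (\<lambda>i. c * x i) \<le> c * V m x"
      using sublinear_fun_scale_le[OF P, of c "\<lambda>i. x i + m * w i"]
      by (intro bexI[of _ "c * m"]) (auto simp: V_def algebra_simps)
  qed (use lower in auto)
  have bdd: "bdd_below ((\<lambda>t. V t x) ` {0..})" for x
    using lower by (auto intro!: bdd_belowI2)
  show "(INF t\<in>{0..}. V t x) \<le> P x" for x
    using cINF_lower[OF bdd, of 0 x] by (simp add: V_def)
  show "(INF t\<in>{0..}. V t (\<lambda>i. - w i)) \<le> - P w"
    using cINF_lower[OF bdd, of 1 "\<lambda>i. - w i"] sublinear_fun_zero[OF P] by (simp add: V_def)
qed

text \<open>A step at \<open>w\<close> does not spoil the oddness already gained at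
  \<open>e\<close>: passing to a minorant lowers Q (- e) and raises - Q e.\<close>

lemma sublinear_fun_odd_minorant:
  assumes "finite E" and "sublinear_fun P"
  shows "\<exists>Q. sublinear_fun Q \<and> (\<forall>x. Q x \<le> P x) \<and> (\<forall>e\<in>E. Q (\<lambda>i. - e i) \<le> - Q e)"
  using assms
proof (induction E rule: finite_induct)
  case (insert w E)
  then obtain Q where Q: "sublinear_fun Q" "\<And>x. Q x \<le> P x" "\<And>e. e \<in> E \<Longrightarrow> Q (\<lambda>i. - e i) \<le> - Q e"
    by blast
  obtain Q' where Q': "sublinear_fun Q'" "\<And>x. Q' x \<le> Q x" "Q' (\<lambda>i. - w i) \<le> - Q w"
    using sublinear_fun_minorant_at[OF Q(1)] by blast
  have "Q' (\<lambda>i. - e i) \<le> - Q' e" if "e \<in> insert w E" for e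
    using that Q(3)[of e] Q'(2)[of "\<lambda>i. - e i"] Q'(2)[of e] Q'(3) by fastforce
  moreover have "Q' x \<le> P x" for x
    using Q(2) Q'(2) by (rule order_trans[rotated])
  ultimately show ?case using Q'(1) by blast
qed auto

text \<open>
  Finite-dimensional Hahn--Banach; \<open>l\<close> lists the values of the functional on the unit vectors.
\<close>
lemma sublinear_fun_support:
  fixes P :: "('i \<Rightarrow> real) \<Rightarrow> real"
  assumes P: "sublinear_fun P" and K: "finite K"
    and w: "\<And>k. k \<in> K \<Longrightarrow> 0 \<le> w k" "\<And>k. k \<notin> K \<Longrightarrow> w k = 0"
  obtains l where "P w \<le> (\<Sum>k\<in>K. w k * l k)"
    "\<And>i j a b. i \<in> K \<Longrightarrow> j \<in> K \<Longrightarrow> 0 \<le> a \<Longrightarrow> 0 \<le> b \<Longrightarrow>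
       a * l i + b * l j \<le> P (\<lambda>k. a * of_bool (k = i) + b * of_bool (k = j))"
proof -
  \<comment> \<open>The first minorant is taken at \<open>w\<close> itself, so every later one still
    satisfies Q (- w) <= - P w, and hence Q w >= P w.\<close>
  obtain P' where P': "sublinear_fun P'" "\<And>x. P' x \<le> P x" "P' (\<lambda>i. - w i) \<le> - P w"
    using sublinear_fun_minorant_at[OF P] by blast
  define e :: "'i \<Rightarrow> 'i \<Rightarrow> real" where "e i = (\<lambda>k. of_bool (k = i))" for i
  obtain Q where Q: "sublinear_fun Q" "\<And>x. Q x \<le> P' x" "\<And>k. k \<in> K \<Longrightarrow> Q (\<lambda>i. - e k i) \<le> - Q (e k)"
    using sublinear_fun_odd_minorant[of "e ` K" P'] K P'(1) by auto
  show thesis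
  proof
    have "w = (\<lambda>i. \<Sum>k\<in>K. w k * e k i)"
      using K w by (auto simp: e_def fun_eq_iff of_bool_def if_distrib[of "\<lambda>x. _ * x"] sum.delta cong: if_cong)
    then have "Q w \<le> (\<Sum>k\<in>K. w k * Q (e k))"
      using sublinear_fun_sum[OF Q(1) K, of w e] w by simp
    moreover have "0 \<le> Q w + Q (\<lambda>i. - w i)"
      using sublinear_fun_add[OF Q(1), of w "\<lambda>i. - w i"] sublinear_fun_zero[OF Q(1)] by simp
    ultimately show "P w \<le> (\<Sum>k\<in>K. w k * Q (e k))"
      using P'(3) Q(2)[of "\<lambda>i. - w i"] by linarith
  next
    fix i j and a b :: real assume ij: "i \<in> K" "j \<in> K" and ab: "0 \<le> a" "0 \<le> b"
    \<comment> \<open>Adding and subtracting b times \<open>e j\<close>: oddness at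
      \<open>e j\<close> turns subadditivity of \<open>Q\<close> into a lower bound for its value at
      the combination of \<open>e i\<close> and \<open>e j\<close>.\<close>
    have "a * Q (e i) = Q (\<lambda>k. (a * e i k + b * e j k) + b * (- e j k))"
      using sublinear_fun_scale[OF Q(1) ab(1), of "e i"] by simp
    also have "\<dots> \<le> Q (\<lambda>k. a * e i k + b * e j k) + b * Q (\<lambda>k. - e j k)"
      using sublinear_fun_add[OF Q(1), of "\<lambda>k. a * e i k + b * e j k" "\<lambda>k. b * (- e j k)"]
        sublinear_fun_scale[OF Q(1) ab(2), of "\<lambda>k. - e j k"] by simp
    also have "\<dots> \<le> P (\<lambda>k. a * e i k + b * e j k) - b * Q (e j)"
      using Q(2)[of "\<lambda>k. a * e i k + b * e j k"] P'(2)[of "\<lambda>k. a * e i k + b * e j k"]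
        mult_left_mono[OF Q(3)[OF ij(2)] ab(2)] by simp
    finally show "a * Q (e i) + b * Q (e j) \<le> P (\<lambda>k. a * of_bool (k = i) + b * of_bool (k = j))"
      by (simp add: e_def)
  qed
qed

section \<open>Transport duality between finitely many atoms\<close>

text \<open>All entries move in the same direction: missing mass is spread evenly over
  \<open>J\<close>, excess mass is removed by proportional scaling, which keeps the signs. The l1
  change is therefore exactly the defect that the penalty in \<open>finite_duality\<close>
  charges.\<close>

lemma correct_total_mass:
  fixes p :: "'j \<Rightarrow> real"
  assumes J: "finite J" "J \<noteq> {}" and p: "\<And>j. 0 \<le> p j" and s: "0 \<le> s"
  shows "\<exists>p'. (\<forall>j. 0 \<le> p' j) \<and> sum p' J = s \<and> (\<Sum>j\<in>J. \<bar>p' j - p j\<bar>) = \<bar>s - sum p J\<bar>"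
proof (cases "sum p J \<le> s")
  case True
  then show ?thesis using J p
    by (intro exI[of _ "\<lambda>j. p j + (s - sum p J) / card J"]) (auto simp: sum.distrib)
next
  case False
  define S where "S = sum p J"
  have S: "0 < S" "s < S" using False s by (auto simp: S_def)
  have "\<bar>p j * s / S - p j\<bar> = p j * ((S - s) / S)" for j
  proof -
    have "p j * s / S - p j = - (p j * ((S - s) / S))" using S by (simp add: field_simps)
    then show ?thesis using S p[of j] by (simp only: abs_minus_cancel) simp
  qed
  then have "(\<Sum>j\<in>J. \<bar>p j * s / S - p j\<bar>) = S * ((S - s) / S)"
    by (simp only: S_def sum_distrib_right)
  moreover have "(\<Sum>j\<in>J. p j * s / S) = S * s / S"
    unfolding S_def by (simp only: sum_distrib_right sum_divide_distrib)
  ultimately show ?thesis using S p s unfolding S_def[symmetric]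
    by (intro exI[of _ "\<lambda>j. p j * s / S"]) auto
qed

text \<open>The rate \<open>R\<close> per unit of changed coefficient becomes the weight of the
  penalty in \<open>finite_duality\<close>.\<close>

lemma norm_scaleR_diff_change:
  fixes x y :: "'a::real_normed_vector"
  assumes "norm x \<le> R" "norm y \<le> R"
  shows "norm (p' *\<^sub>R x - q' *\<^sub>R y) \<le> norm (p *\<^sub>R x - q *\<^sub>R y) + R * \<bar>p' - p\<bar> + R * \<bar>q' - q\<bar>"
proof -
  have "p' *\<^sub>R x - q' *\<^sub>R y = (p *\<^sub>R x - q *\<^sub>R y) + (p' - p) *\<^sub>R x - (q' - q) *\<^sub>R y"
    by (simp add: algebra_simps)
  also have "norm \<dots> \<le> norm (p *\<^sub>R x - q *\<^sub>R y) + norm ((p' - p) *\<^sub>R x) + norm ((q' - q) *\<^sub>R y)"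
    by (meson add_right_mono norm_triangle_ineq norm_triangle_ineq4 order_trans)
  also have "\<dots> \<le> norm (p *\<^sub>R x - q *\<^sub>R y) + R * \<bar>p' - p\<bar> + R * \<bar>q' - q\<bar>"
    using assms by (intro add_mono) (auto simp: mult.commute[of R] mult_left_mono)
  finally show ?thesis .
qed

text \<open>
  Since \<open>(p, q) \<mapsto> norm (p x - q y)\<close> is sublinear, all the mass of a finitely supported plan carried
  by a pair \<open>(x, y)\<close> can be merged into one atom, so that a plan is a pair of matrices. The
  marginal constraints are relaxed with a penalty so large that it is exact; the relaxed value is a
  sublinear function of arbitrary signed marginals, to which Hahn--Banach applies.
\<close>
lemma finite_duality:
  fixes I J :: "'a::real_normed_vector set" and s t :: "'a \<Rightarrow> real"
  assumes I: "finite I" "I \<noteq> {}" and J: "finite J" "J \<noteq> {}"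
    and s: "\<And>i. i \<in> I \<Longrightarrow> 0 \<le> s i" and t: "\<And>j. j \<in> J \<Longrightarrow> 0 \<le> t j" and eta: "0 < \<eta>"
  obtains p q f g where "\<And>i j. 0 \<le> p i j" "\<And>i j. 0 \<le> q i j"
    "\<And>i. i \<in> I \<Longrightarrow> (\<Sum>j\<in>J. p i j) = s i" "\<And>j. j \<in> J \<Longrightarrow> (\<Sum>i\<in>I. q i j) = t j"
    "\<And>i j a b. i \<in> I \<Longrightarrow> j \<in> J \<Longrightarrow> 0 \<le> a \<Longrightarrow> 0 \<le> b \<Longrightarrow> a * f i + b * g j \<le> norm (a *\<^sub>R i - b *\<^sub>R j)"
    "(\<Sum>i\<in>I. \<Sum>j\<in>J. norm (p i j *\<^sub>R i - q i j *\<^sub>R j)) \<le> (\<Sum>i\<in>I. s i * f i) + (\<Sum>j\<in>J. t j * g j) + \<eta>"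
proof -
  \<comment> \<open>One unit of marginal defect can be repaired at a cost of at most the largest
    norm of an atom, so this is the weight at which the penalty is exact.\<close>
  define R where "R = Max (norm ` (I \<union> J))"
  have R: "norm x \<le> R" if "x \<in> I \<union> J" for x
    unfolding R_def using that I J by (intro Max_ge) auto
  have R0: "0 \<le> R" using R I(2) norm_ge_zero order_trans by blast
  define S :: "(('a \<Rightarrow> 'a \<Rightarrow> real) \<times> ('a \<Rightarrow> 'a \<Rightarrow> real)) set"
    where "S = {(p, q). \<forall>i j. 0 \<le> p i j \<and> 0 \<le> q i j}"
  define V :: "(('a \<Rightarrow> 'a \<Rightarrow> real) \<times> ('a \<Rightarrow> 'a \<Rightarrow> real)) \<Rightarrow> ('a + 'a \<Rightarrow> real) \<Rightarrow> real"
    where "V = (\<lambda>(p, q) w. (\<Sum>i\<in>I. \<Sum>j\<in>J. norm (p i j *\<^sub>R i - q i j *\<^sub>R j))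
      + R * (\<Sum>i\<in>I. \<bar>w (Inl i) - (\<Sum>j\<in>J. p i j)\<bar>) + R * (\<Sum>j\<in>J. \<bar>w (Inr j) - (\<Sum>i\<in>I. q i j)\<bar>))"
  have V0: "0 \<le> V m w" for m w
    using R0 by (cases m) (auto simp: V_def intro!: add_nonneg_nonneg sum_nonneg mult_nonneg_nonneg)
  define P where "P = (\<lambda>w. INF m\<in>S. V m w)"
  have bdd: "bdd_below ((\<lambda>m. V m w) ` S)" for w
    using V0 by (auto intro!: bdd_belowI2)
  have S_ne: "S \<noteq> {}" by (auto simp: S_def intro!: exI[of _ "\<lambda>_ _. 0"])
  have "sublinear_fun P"
    unfolding P_def
  proof (rule sublinear_fun_INF[where L = "\<lambda>_. 0"])
    fix m n and x y :: "'a + 'a \<Rightarrow> real" assume "m \<in> S" "n \<in> S"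
    then obtain p q p' q' where mn: "m = (p, q)" "n = (p', q')" "(p, q) \<in> S" "(p', q') \<in> S"
      by (cases m; cases n) auto
    have "norm ((p i j + p' i j) *\<^sub>R i - (q i j + q' i j) *\<^sub>R j)
        \<le> norm (p i j *\<^sub>R i - q i j *\<^sub>R j) + norm (p' i j *\<^sub>R i - q' i j *\<^sub>R j)" for i j
      using norm_triangle_ineq[of "p i j *\<^sub>R i - q i j *\<^sub>R j" "p' i j *\<^sub>R i - q' i j *\<^sub>R j"]
      by (simp add: algebra_simps)
    then have 1: "(\<Sum>i\<in>I. \<Sum>j\<in>J. norm ((p i j + p' i j) *\<^sub>R i - (q i j + q' i j) *\<^sub>R j))
        \<le> (\<Sum>i\<in>I. \<Sum>j\<in>J. norm (p i j *\<^sub>R i - q i j *\<^sub>R j)) + (\<Sum>i\<in>I. \<Sum>j\<in>J. norm (p' i j *\<^sub>R i - q' i j *\<^sub>R j))"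
      unfolding sum.distrib[symmetric] by (intro sum_mono)
    have 2: "(\<Sum>i\<in>I. \<bar>x (Inl i) + y (Inl i) - (\<Sum>j\<in>J. p i j + p' i j)\<bar>)
        \<le> (\<Sum>i\<in>I. \<bar>x (Inl i) - (\<Sum>j\<in>J. p i j)\<bar>) + (\<Sum>i\<in>I. \<bar>y (Inl i) - (\<Sum>j\<in>J. p' i j)\<bar>)"
      unfolding sum.distrib[where A = I, symmetric] by (intro sum_mono) (simp add: sum.distrib)
    have 3: "(\<Sum>j\<in>J. \<bar>x (Inr j) + y (Inr j) - (\<Sum>i\<in>I. q i j + q' i j)\<bar>)
        \<le> (\<Sum>j\<in>J. \<bar>x (Inr j) - (\<Sum>i\<in>I. q i j)\<bar>) + (\<Sum>j\<in>J. \<bar>y (Inr j) - (\<Sum>i\<in>I. q' i j)\<bar>)"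
      unfolding sum.distrib[where A = J, symmetric] by (intro sum_mono) (simp add: sum.distrib)
    have "V (\<lambda>i j. p i j + p' i j, \<lambda>i j. q i j + q' i j) (\<lambda>i. x i + y i) \<le> V m x + V n y"
      using 1 mult_left_mono[OF 2 R0] mult_left_mono[OF 3 R0]
      unfolding mn V_def by (simp add: distrib_left)
    then show "\<exists>k\<in>S. V k (\<lambda>i. x i + y i) \<le> V m x + V n y"
      using mn(3,4) by (intro bexI[of _ "(\<lambda>i j. p i j + p' i j, \<lambda>i j. q i j + q' i j)"]) (auto simp: S_def)
  next
    fix m and x :: "'a + 'a \<Rightarrow> real" and c :: real assume "m \<in> S" and c: "0 \<le> c"
    then obtain p q where m: "m = (p, q)" "(p, q) \<in> S" by (cases m) auto
    have 1: "norm ((c * p i j) *\<^sub>R i - (c * q i j) *\<^sub>R j) = c * norm (p i j *\<^sub>R i - q i j *\<^sub>R j)" for i j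
    proof -
      have "(c * p i j) *\<^sub>R i - (c * q i j) *\<^sub>R j = c *\<^sub>R (p i j *\<^sub>R i - q i j *\<^sub>R j)"
        by (simp add: algebra_simps)
      then show ?thesis using c by simp
    qed
    have 2: "\<bar>c * z - c * z'\<bar> = c * \<bar>z - z'\<bar>" for z z' :: real
      using c by (simp add: right_diff_distrib[symmetric] abs_mult)
    have "V (\<lambda>i j. c * p i j, \<lambda>i j. c * q i j) (\<lambda>i. c * x i) = c * V m x"
      unfolding m V_def prod.case 1 sum_distrib_left[symmetric] 2 by (simp add: algebra_simps)
    then show "\<exists>k\<in>S. V k (\<lambda>i. c * x i) \<le> c * V m x"
      using m(2) c by (intro bexI[of _ "(\<lambda>i j. c * p i j, \<lambda>i j. c * q i j)"]) (auto simp: S_def)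
  qed (use V0 S_ne in auto)
  \<comment> \<open>The index type \<open>'a + 'a\<close> keeps the two marginals apart even when
    \<open>I\<close> and \<open>J\<close> overlap.\<close>
  define w where "w k = (case k of Inl i \<Rightarrow> if i \<in> I then s i else 0 | Inr j \<Rightarrow> if j \<in> J then t j else 0)" for k
  obtain l where l: "P w \<le> (\<Sum>k\<in>I <+> J. w k * l k)"
    "\<And>i j a b. i \<in> I <+> J \<Longrightarrow> j \<in> I <+> J \<Longrightarrow> 0 \<le> a \<Longrightarrow> 0 \<le> b \<Longrightarrow>
       a * l i + b * l j \<le> P (\<lambda>k. a * of_bool (k = i) + b * of_bool (k = j))"
  proof (rule sublinear_fun_support[OF \<open>sublinear_fun P\<close>, of "I <+> J" w])
    show "finite (I <+> J)" using I J by simp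
    show "0 \<le> w k" if "k \<in> I <+> J" for k
      using that s t by (auto simp: w_def)
    show "w k = 0" if "k \<notin> I <+> J" for k
      using that by (auto simp: w_def split: sum.splits)
  qed blast
  \<comment> \<open>The slack \<eta> replaces attainment of the infimum.\<close>
  obtain p q where pq: "(p, q) \<in> S" "V (p, q) w < P w + \<eta>"
    using cINF_less_iff[OF S_ne bdd, of w "P w + \<eta>"] eta by (auto simp: P_def)
  \<comment> \<open>\<open>p\<close> is constrained only through its row sums and \<open>q\<close>
    only through its column sums, so the two are corrected independently; \<open>q'\<close> takes
    the column as its first index.\<close>
  have "\<forall>i. \<exists>p'. i \<in> I \<longrightarrow> (\<forall>j. 0 \<le> p' j) \<and> sum p' J = s i \<and> (\<Sum>j\<in>J. \<bar>p' j - p i j\<bar>) = \<bar>s i - sum (p i) J\<bar>"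
    using correct_total_mass[OF J, of "p _" "s _"] pq(1) s by (auto simp: S_def)
  then obtain p' where p': "\<And>i j. i \<in> I \<Longrightarrow> 0 \<le> p' i j" "\<And>i. i \<in> I \<Longrightarrow> sum (p' i) J = s i"
    "\<And>i. i \<in> I \<Longrightarrow> (\<Sum>j\<in>J. \<bar>p' i j - p i j\<bar>) = \<bar>s i - sum (p i) J\<bar>"
    by metis
  have "\<forall>j. \<exists>q'. j \<in> J \<longrightarrow> (\<forall>i. 0 \<le> q' i) \<and> sum q' I = t j \<and>
      (\<Sum>i\<in>I. \<bar>q' i - q i j\<bar>) = \<bar>t j - (\<Sum>i\<in>I. q i j)\<bar>"
    using correct_total_mass[OF I, of "\<lambda>i. q i _" "t _"] pq(1) t by (auto simp: S_def)
  then obtain q' where q': "\<And>i j. j \<in> J \<Longrightarrow> 0 \<le> q' j i" "\<And>j. j \<in> J \<Longrightarrow> sum (q' j) I = t j"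
    "\<And>j. j \<in> J \<Longrightarrow> (\<Sum>i\<in>I. \<bar>q' j i - q i j\<bar>) = \<bar>t j - (\<Sum>i\<in>I. q i j)\<bar>"
    by metis
  show thesis
  proof
    show "0 \<le> (if i \<in> I then p' i j else 0)" "0 \<le> (if j \<in> J then q' j i else 0)" for i j
      using p' q' by auto
    show "(\<Sum>j\<in>J. if i \<in> I then p' i j else 0) = s i" if "i \<in> I" for i
      using p'(2) that by simp
    show "(\<Sum>i\<in>I. if j \<in> J then q' j i else 0) = t j" if "j \<in> J" for j
      using q'(2) that by simp
    fix i j and a b :: real assume ij: "i \<in> I" "j \<in> J" and ab: "0 \<le> a" "0 \<le> b"
    \<comment> \<open>The competitor puts \<open>a\<close> and \<open>b\<close> on the single pair
      \<open>(i, j)\<close>. Both marginals match, so the penalties vanish and only the norm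
      remains.\<close>
    define m where "m = (\<lambda>i' j'. a * of_bool (i' = i \<and> j' = j), \<lambda>i' j'. b * of_bool (i' = i \<and> j' = j))"
    have "P (\<lambda>k. a * of_bool (k = Inl i) + b * of_bool (k = Inr j)) \<le>
        V m (\<lambda>k. a * of_bool (k = Inl i) + b * of_bool (k = Inr j))"
      unfolding P_def using ab by (intro cINF_lower[OF bdd]) (auto simp: S_def m_def)
    also have "\<dots> = norm (a *\<^sub>R i - b *\<^sub>R j)"
    proof -
      have [simp]: "(\<Sum>j'\<in>J. a * of_bool (i' = i \<and> j' = j)) = a * of_bool (i' = i)" for i'
        using J ij by (cases "i' = i") (auto simp: sum_distrib_left[symmetric] of_bool_def sum.delta)
      have [simp]: "(\<Sum>i'\<in>I. b * of_bool (i' = i \<and> j' = j)) = b * of_bool (j' = j)" for j'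
        using I ij by (cases "j' = j") (auto simp: sum_distrib_left[symmetric] of_bool_def sum.delta)
      have "norm ((a * of_bool (i' = i \<and> j' = j)) *\<^sub>R i' - (b * of_bool (i' = i \<and> j' = j)) *\<^sub>R j')
          = (if i' = i then if j' = j then norm (a *\<^sub>R i - b *\<^sub>R j) else 0 else 0)" for i' j'
        by auto
      moreover have "(\<Sum>i'\<in>I. \<Sum>j'\<in>J. if i' = i then if j' = j then norm (a *\<^sub>R i - b *\<^sub>R j) else 0 else 0)
          = (\<Sum>i'\<in>I. if i' = i then \<Sum>j'\<in>J. if j' = j then norm (a *\<^sub>R i - b *\<^sub>R j) else 0 else 0)"
        by (intro sum.cong) auto
      ultimately show ?thesis using ij I J by (simp add: V_def m_def sum.delta)
    qed
    finally show "a * l (Inl i) + b * l (Inr j) \<le> norm (a *\<^sub>R i - b *\<^sub>R j)"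
      using l(2)[of "Inl i" "Inr j" a b] ij ab by force
  next
    \<comment> \<open>Passing to the corrected pair costs at most \<open>R\<close> times the
      marginal defects, which is what \<open>V (p, q) w\<close> already contains.\<close>
    have "(\<Sum>i\<in>I. \<Sum>j\<in>J. norm ((if i \<in> I then p' i j else 0) *\<^sub>R i - (if j \<in> J then q' j i else 0) *\<^sub>R j))
        \<le> (\<Sum>i\<in>I. \<Sum>j\<in>J. norm (p i j *\<^sub>R i - q i j *\<^sub>R j) + R * \<bar>p' i j - p i j\<bar> + R * \<bar>q' j i - q i j\<bar>)"
      using R by (intro sum_mono) (auto intro!: norm_scaleR_diff_change)
    also have "\<dots> = (\<Sum>i\<in>I. \<Sum>j\<in>J. norm (p i j *\<^sub>R i - q i j *\<^sub>R j))
        + R * (\<Sum>i\<in>I. \<Sum>j\<in>J. \<bar>p' i j - p i j\<bar>) + R * (\<Sum>i\<in>I. \<Sum>j\<in>J. \<bar>q' j i - q i j\<bar>)"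
      by (simp add: sum.distrib sum_distrib_left)
    also have "(\<Sum>i\<in>I. \<Sum>j\<in>J. \<bar>q' j i - q i j\<bar>) = (\<Sum>j\<in>J. \<Sum>i\<in>I. \<bar>q' j i - q i j\<bar>)"
      by (rule sum.swap)
    finally have "(\<Sum>i\<in>I. \<Sum>j\<in>J. norm ((if i \<in> I then p' i j else 0) *\<^sub>R i - (if j \<in> J then q' j i else 0) *\<^sub>R j))
        \<le> V (p, q) w"
      using p'(3) q'(3) by (simp add: V_def w_def)
    also have "\<dots> \<le> (\<Sum>k\<in>I <+> J. w k * l k) + \<eta>" using pq(2) l(1) by simp
    also have "(\<Sum>k\<in>I <+> J. w k * l k) = (\<Sum>i\<in>I. s i * l (Inl i)) + (\<Sum>j\<in>J. t j * l (Inr j))"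
      using I J by (simp add: sum.Plus w_def)
    finally show "(\<Sum>i\<in>I. \<Sum>j\<in>J. norm ((if i \<in> I then p' i j else 0) *\<^sub>R i - (if j \<in> J then q' j i else 0) *\<^sub>R j))
        \<le> (\<Sum>i\<in>I. s i * l (Inl i)) + (\<Sum>j\<in>J. t j * l (Inr j)) + \<eta>" .
  qed
qed

section \<open>Extension of potentials to the ambient space\<close>

text \<open>\<open>h\<close> is the least function with the first property that dominates
  \<open>f\<close> on \<open>I\<close>; the compatibility of \<open>f\<close> and \<open>g\<close>
  keeps it below \<open>- g\<close> on \<open>J\<close>. Positive homogeneity comes from letting the
  parameter \<open>c\<close> range over a cone.\<close>

lemma homogeneous_potential:
  fixes I J :: "'a::real_normed_vector set"
  assumes "I \<noteq> {}" "J \<noteq> {}"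
    and fg: "\<And>i j a b. i \<in> I \<Longrightarrow> j \<in> J \<Longrightarrow> 0 \<le> a \<Longrightarrow> 0 \<le> b \<Longrightarrow> a * f i + b * g j \<le> norm (a *\<^sub>R i - b *\<^sub>R j)"
  obtains h where
    "\<And>x y a b. 0 \<le> a \<Longrightarrow> 0 \<le> b \<Longrightarrow> a * h x - b * h y \<le> norm (a *\<^sub>R x - b *\<^sub>R y)"
    "\<And>i. i \<in> I \<Longrightarrow> f i \<le> h i" "\<And>j. j \<in> J \<Longrightarrow> g j \<le> - h j"
proof -
  define W where "W = (\<lambda>(c, i) y. c * f i - norm (c *\<^sub>R i - y))"
  define h where "h y = (SUP m\<in>{0..} \<times> I. W m y)" for y
  \<comment> \<open>The hypothesis with vanishing second coefficient bounds \<open>f\<close>, and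
    this bounds the supremum at \<open>y\<close> by \<open>norm y\<close>.\<close>
  have f_le: "c * f i \<le> norm (c *\<^sub>R i)" if "0 \<le> c" "i \<in> I" for c i
    using fg[OF that(2) _ that(1), of _ 0] \<open>J \<noteq> {}\<close> by auto
  have bdd: "bdd_above ((\<lambda>m. W m y) ` ({0..} \<times> I))" for y
  proof (rule bdd_aboveI2)
    fix m :: "real \<times> 'a" assume "m \<in> {0..} \<times> I"
    then show "W m y \<le> norm y"
      using f_le[of "fst m" "snd m"] norm_triangle_sub[of "fst m *\<^sub>R snd m" y]
      by (cases m) (auto simp: W_def)
  qed
  have W_le: "c * f i - norm (c *\<^sub>R i - y) \<le> h y" if "0 \<le> c" "i \<in> I" for c i y
    using cSUP_upper[OF _ bdd, of "(c, i)" y] that by (simp add: h_def W_def)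
  have h_le: "h y \<le> z" if "\<And>c i. 0 \<le> c \<Longrightarrow> i \<in> I \<Longrightarrow> c * f i - norm (c *\<^sub>R i - y) \<le> z" for y z
    unfolding h_def using that \<open>I \<noteq> {}\<close> by (intro cSUP_least) (auto simp: W_def)
  show thesis
  proof
    fix x y and a b :: real assume ab: "0 \<le> a" "0 \<le> b"
    show "a * h x - b * h y \<le> norm (a *\<^sub>R x - b *\<^sub>R y)"
    proof (cases "a = 0")
      case True
      obtain i where "i \<in> I" using \<open>I \<noteq> {}\<close> by blast
      \<comment> \<open>The parameter c = 0 in the supremum supplies the lower bound on
        \<open>h\<close>.\<close>
      then have "- norm y \<le> h y" using W_le[of 0 i y] by simp
      then show ?thesis using True ab mult_left_mono[of "- norm y" "h y" b] by simp
    next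
      case False
      then have a: "0 < a" using ab by simp
      have "h x \<le> (norm (a *\<^sub>R x - b *\<^sub>R y) + b * h y) / a"
      proof (rule h_le)
        fix c :: real and i assume ci: "0 \<le> c" "i \<in> I"
        have eq: "a * norm (c *\<^sub>R i - x) = norm ((a * c) *\<^sub>R i - a *\<^sub>R x)"
          using a norm_scaleR[of a "c *\<^sub>R i - x"] by (simp add: scaleR_diff_right)
        have tri: "norm ((a * c) *\<^sub>R i - b *\<^sub>R y)
            \<le> norm ((a * c) *\<^sub>R i - a *\<^sub>R x) + norm (a *\<^sub>R x - b *\<^sub>R y)"
          using norm_triangle_ineq[of "(a * c) *\<^sub>R i - a *\<^sub>R x" "a *\<^sub>R x - b *\<^sub>R y"] by simp
        \<comment> \<open>Homogeneity enters here: \<open>a * c / b\<close> is again an admissible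
          parameter. For b = 0 the term with \<open>h\<close> disappears and \<open>f_le\<close>
          takes over.\<close>
        have "(a * c) * f i - norm ((a * c) *\<^sub>R i - b *\<^sub>R y) \<le> b * h y"
        proof (cases "b = 0")
          case True
          then show ?thesis using f_le[of "a * c" i] ci a by simp
        next
          case False
          then have b: "0 < b" using ab by simp
          have "b * ((a * c / b) * f i - norm ((a * c / b) *\<^sub>R i - y)) \<le> b * h y"
            using W_le[of "a * c / b" i y] a b ci by (intro mult_left_mono) auto
          moreover have "b * norm ((a * c / b) *\<^sub>R i - y) = norm ((a * c) *\<^sub>R i - b *\<^sub>R y)"
            using b norm_scaleR[of b "(a * c / b) *\<^sub>R i - y"] by (simp add: scaleR_diff_right)
          ultimately show ?thesis using b by (simp add: right_diff_distrib)
        qed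
        then have "a * (c * f i - norm (c *\<^sub>R i - x)) \<le> norm (a *\<^sub>R x - b *\<^sub>R y) + b * h y"
          using eq tri by (simp add: right_diff_distrib mult.assoc)
        then show "c * f i - norm (c *\<^sub>R i - x) \<le> (norm (a *\<^sub>R x - b *\<^sub>R y) + b * h y) / a"
          using a by (simp add: le_divide_eq mult.commute)
      qed
      then show ?thesis using a by (simp add: le_divide_eq mult.commute)
    qed
  next
    fix i assume "i \<in> I"
    then show "f i \<le> h i" using W_le[of 1 i i] by simp
  next
    fix j assume "j \<in> J"
    then have "h j \<le> - g j"
      using fg[of _ j _ 1] by (intro h_le) force
    then show "g j \<le> - h j" by simp
  qed
qed

section \<open>Borel structure and integration on compact sets\<close>

text \<open>
  The ambient space need not be second countable, so its Borel sets do not multiply; compactness of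
  the factors is what makes the two sigma-algebras agree.
\<close>
lemma measurable_pair_borel_compact:
  fixes A :: "'a::metric_space set" and B :: "'b::metric_space set"
  assumes "compact A" "compact B"
  shows "(\<lambda>z. z) \<in> measurable (restrict_space borel A \<Otimes>\<^sub>M restrict_space borel B) (restrict_space borel (A \<times> B))"
proof (rule measurable_restrict_space2)
  let ?M = "restrict_space borel A \<Otimes>\<^sub>M restrict_space borel B"
  show "(\<lambda>z. z) \<in> space ?M \<rightarrow> A \<times> B" by (auto simp: space_pair_measure space_restrict_space)
  define \<epsilon> where "\<epsilon> n = inverse (real (Suc n))" for n
  have eps: "0 < \<epsilon> n" for n by (simp add: \<epsilon>_def)
  have "\<forall>n. \<exists>k. finite k \<and> A \<subseteq> (\<Union>x\<in>k. ball x (\<epsilon> n))" "\<forall>n. \<exists>k. finite k \<and> B \<subseteq> (\<Union>x\<in>k. ball x (\<epsilon> n))"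
    using assms eps unfolding compact_eq_totally_bounded by blast+
  then obtain k l where k: "\<And>n. finite (k n)" "\<And>n. A \<subseteq> (\<Union>x\<in>k n. ball x (\<epsilon> n))"
    and l: "\<And>n. finite (l n)" "\<And>n. B \<subseteq> (\<Union>x\<in>l n. ball x (\<epsilon> n))"
    by metis
  show "(\<lambda>z. z) \<in> borel_measurable ?M"
  proof (rule borel_measurableI)
    fix S :: "('a \<times> 'b) set" assume S: "open S"
    define G where "G n a b = (A \<inter> ball a (\<epsilon> n)) \<times> (B \<inter> ball b (\<epsilon> n))" for n a b
    \<comment> \<open>The boxes come from finite nets of radius 1 / (n + 1), so those contained in
      \<open>S\<close> form a countable family; they exhaust the part of \<open>S\<close> in the
      product.\<close>
    have "(\<lambda>z. z) -` S \<inter> space ?M = (\<Union>n. \<Union>a\<in>k n. \<Union>b\<in>l n. if G n a b \<subseteq> S then G n a b else {})"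
    proof (intro equalityI subsetI)
      fix z assume "z \<in> (\<lambda>z. z) -` S \<inter> space ?M"
      then obtain x y where z: "z = (x, y)" "x \<in> A" "y \<in> B" "(x, y) \<in> S"
        by (auto simp: space_pair_measure space_restrict_space)
      obtain U V where UV: "open U" "open V" "x \<in> U" "y \<in> V" "U \<times> V \<subseteq> S"
        using open_prod_elim[OF S z(4)] by (metis SigmaE2 z(4) mem_Sigma_iff)
      obtain d where d: "0 < d" "ball x d \<subseteq> U" using UV openE by blast
      obtain e where e: "0 < e" "ball y e \<subseteq> V" using UV openE by blast
      \<comment> \<open>The box containing \<open>z\<close> need not be centred there, whence the
        factor 2.\<close>
      obtain n where n: "\<epsilon> n < min d e / 2"
        using reals_Archimedean[of "min d e / 2"] d e by (auto simp: \<epsilon>_def)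
      obtain a where a: "a \<in> k n" "x \<in> ball a (\<epsilon> n)" using k(2) z(2) by blast
      obtain b where b: "b \<in> l n" "y \<in> ball b (\<epsilon> n)" using l(2) z(3) by blast
      have "ball a (\<epsilon> n) \<subseteq> ball x d"
      proof
        fix w assume "w \<in> ball a (\<epsilon> n)"
        then show "w \<in> ball x d" using a n dist_triangle[of x w a] by (auto simp: dist_commute)
      qed
      moreover have "ball b (\<epsilon> n) \<subseteq> ball y e"
      proof
        fix w assume "w \<in> ball b (\<epsilon> n)"
        then show "w \<in> ball y e" using b n dist_triangle[of y w b] by (auto simp: dist_commute)
      qed
      ultimately have "G n a b \<subseteq> S" using d e UV(5) unfolding G_def by blast
      moreover have "z \<in> G n a b" using z a b by (simp add: G_def)
      ultimately show "z \<in> (\<Union>n. \<Union>a\<in>k n. \<Union>b\<in>l n. if G n a b \<subseteq> S then G n a b else {})"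
        using a b by (auto intro!: exI[of _ n] bexI[of _ a] bexI[of _ b])
    qed (auto simp: space_pair_measure space_restrict_space G_def split: if_splits)
    also have "\<dots> \<in> sets ?M"
    proof -
      have "A \<inter> ball a (\<epsilon> n) \<in> sets (restrict_space borel A)" "B \<inter> ball b (\<epsilon> n) \<in> sets (restrict_space borel B)" for n a b
        by (auto simp: sets_restrict_space)
      then have "(if G n a b \<subseteq> S then G n a b else {}) \<in> sets ?M" for n a b
        by (auto simp: G_def)
      then show ?thesis
        using k(1) l(1) by (intro sets.countable_UN image_subsetI sets.finite_UN) auto
    qed
    finally show "(\<lambda>z. z) -` S \<inter> space ?M \<in> sets ?M" .
  qed
qed

lemma
  assumes "u \<in> Delta X"
  shows Delta_prob_space: "prob_space u"
    and Delta_sets: "sets u = sets (restrict_space borel X)"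
    and Delta_space: "space u = X"
  using assms sets_eq_imp_space_eq[of u "restrict_space borel X"] by (auto simp: Delta_def space_restrict_space)

lemma Delta_nonempty: "u \<in> Delta X \<Longrightarrow> X \<noteq> {}"
  using prob_space.not_empty[of u] Delta_prob_space Delta_space by metis

lemma Delta_measurable:
  "u \<in> Delta X \<Longrightarrow> continuous_on X f \<Longrightarrow> f \<in> borel_measurable u"
  using borel_measurable_continuous_on_restrict[of X f] measurable_cong_sets[OF Delta_sets refl] by blast

lemma continuous_compact_bounded:
  fixes f :: "'a::topological_space \<Rightarrow> real"
  assumes "compact X" "continuous_on X f"
  obtains C where "0 \<le> C" "\<And>x. x \<in> X \<Longrightarrow> \<bar>f x\<bar> \<le> C"
proof -
  obtain C where "\<And>x. x \<in> X \<Longrightarrow> norm (f x) \<le> C"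
    using compact_imp_bounded[OF compact_continuous_image[OF assms(2,1)]] by (auto simp: bounded_iff)
  then show thesis by (intro that[of "\<bar>C\<bar>"]) force+
qed

lemma Delta_integrable:
  fixes f :: "'a::real_normed_vector \<Rightarrow> real"
  assumes "compact X" "u \<in> Delta X" "continuous_on X f"
  shows "integrable u f"
proof -
  interpret prob_space u by (rule Delta_prob_space) fact
  obtain C where "\<And>x. x \<in> X \<Longrightarrow> \<bar>f x\<bar> \<le> C" using continuous_compact_bounded assms by blast
  then show ?thesis using Delta_measurable[OF assms(2,3)] Delta_space[OF assms(2)]
    by (intro integrable_const_bound[of _ C]) auto
qed

lemma Delta_integral_le:
  assumes "compact X" "u \<in> Delta X" "continuous_on X f" "\<And>x. x \<in> X \<Longrightarrow> f x \<le> (C::real)"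
  shows "integral\<^sup>L u f \<le> C"
proof -
  interpret prob_space u by (rule Delta_prob_space) fact
  show ?thesis
    using Delta_integrable assms Delta_space[OF assms(2)] by (intro integral_le_const) auto
qed

section \<open>Plans built from densities\<close>

text \<open>The densities may exceed 1, whereas the last two coordinates of a plan lie in [0,1].
  Cost and marginals are positively homogeneous in the coefficients, so both coefficients are
  divided by \<open>P + Q\<close> and the mass is multiplied by it.\<close>

lemma M3_from_densities:
  fixes X :: "'a::real_normed_vector set" and P Q :: "'a \<times> 'a \<Rightarrow> real"
  assumes X: "compact X" and u: "u \<in> Delta X" and v: "v \<in> Delta X"
    and int: "integrable (u \<Otimes>\<^sub>M v) P" "integrable (u \<Otimes>\<^sub>M v) Q"
    and nn: "\<And>z. 0 \<le> P z" "\<And>z. 0 \<le> Q z"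
    and margP: "AE x in u. (\<integral>y. P (x, y) \<partial>v) = 1" and margQ: "AE y in v. (\<integral>x. Q (x, y) \<partial>u) = 1"
  obtains \<gamma> where "\<gamma> \<in> M3 X u v"
    "(\<integral>z. (case z of (x, y, l, m) \<Rightarrow> norm (l *\<^sub>R x - m *\<^sub>R y)) \<partial>\<gamma>)
      = (\<integral>z. norm (P z *\<^sub>R fst z - Q z *\<^sub>R snd z) \<partial>(u \<Otimes>\<^sub>M v))"
proof -
  interpret u: prob_space u by (rule Delta_prob_space) fact
  interpret v: prob_space v by (rule Delta_prob_space) fact
  interpret uv: pair_prob_space u v ..
  let ?M = "u \<Otimes>\<^sub>M v"
  note [measurable_cong] = Delta_sets[OF u] Delta_sets[OF v]
  note [simp] = Delta_space[OF u] Delta_space[OF v]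
  have [measurable]: "P \<in> borel_measurable ?M" "Q \<in> borel_measurable ?M" using int by auto
  define W where "W z = P z + Q z" for z
  have W_nn: "0 \<le> W z" for z using nn[of z] by (simp add: W_def)
  \<comment> \<open>Where \<open>W z\<close> vanishes so do \<open>P z\<close> and
    \<open>Q z\<close>, hence the identities survive the convention x / 0 = 0.\<close>
  have W_mult: "W z * (P z / W z) = P z" "W z * (Q z / W z) = Q z" for z
    using nn[of z] by (cases "W z = 0"; simp add: W_def add_nonneg_eq_0_iff)+
  have [measurable]: "W \<in> borel_measurable ?M" unfolding W_def by measurable
  have W_int: "integrable ?M W" unfolding W_def using int by simp
  define Z where "Z = X \<times> X \<times> {0..1::real} \<times> {0..1::real}"
  define T where "T z = (fst z, snd z, P z / W z, Q z / W z)" for z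
  \<comment> \<open>Coordinates are joined one at a time; compactness allows the passage to the
    Borel sets of the product at each stage.\<close>
  have T: "T \<in> measurable ?M (restrict_space borel Z)"
  proof -
    have "(\<lambda>z. (P z / W z, Q z / W z)) \<in> measurable ?M (restrict_space borel ({0..1} \<times> {0..1}))"
    proof (intro measurable_restrict_space2)
      have "P z / W z \<in> {0..1}" "Q z / W z \<in> {0..1}" for z
        using nn[of z] W_nn[of z] by (auto simp: W_def divide_le_eq_1)
      then show "(\<lambda>z. (P z / W z, Q z / W z)) \<in> space ?M \<rightarrow> {0..1} \<times> {0..1}" by auto
    qed measurable
    moreover have snd: "snd \<in> measurable ?M (restrict_space borel X)" by measurable
    ultimately have "(\<lambda>z. (snd z, P z / W z, Q z / W z)) \<in>
        measurable ?M (restrict_space borel X \<Otimes>\<^sub>M restrict_space borel ({0..1} \<times> {0..1}))"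
      by (rule measurable_Pair[rotated])
    then have "(\<lambda>z. (snd z, P z / W z, Q z / W z)) \<in> measurable ?M (restrict_space borel (X \<times> {0..1} \<times> {0..1}))"
      by (rule measurable_compose[OF _ measurable_pair_borel_compact]) (intro X compact_Times compact_Icc)+
    moreover have fst: "fst \<in> measurable ?M (restrict_space borel X)" by measurable
    ultimately have "T \<in> measurable ?M (restrict_space borel X \<Otimes>\<^sub>M restrict_space borel (X \<times> {0..1} \<times> {0..1}))"
      unfolding T_def by (rule measurable_Pair[rotated])
    then show ?thesis unfolding Z_def
      by (rule measurable_compose[OF _ measurable_pair_borel_compact]) (intro X compact_Times compact_Icc)+
  qed
  define \<gamma> where "\<gamma> = distr (density ?M W) (restrict_space borel Z) T"
  have T': "T \<in> measurable (density ?M W) (restrict_space borel Z)" using T by simp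
  have integral: "(\<integral>z. \<phi> z \<partial>\<gamma>) = (\<integral>z. W z * \<phi> (T z) \<partial>?M)" if "continuous_on Z \<phi>" for \<phi> :: "_ \<Rightarrow> real"
  proof -
    have \<phi>: "\<phi> \<in> borel_measurable (restrict_space borel Z)"
      using that by (rule borel_measurable_continuous_on_restrict)
    then have "(\<integral>z. \<phi> z \<partial>\<gamma>) = (\<integral>z. \<phi> (T z) \<partial>density ?M W)"
      unfolding \<gamma>_def by (rule integral_distr[OF T'])
    also have "\<dots> = (\<integral>z. W z * \<phi> (T z) \<partial>?M)"
      using measurable_compose[OF T \<phi>] W_nn by (subst integral_density) auto
    finally show ?thesis .
  qed
  show thesis
  proof
    have "emeasure \<gamma> (space \<gamma>) = (\<integral>\<^sup>+z. W z \<partial>?M)"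
      using T by (simp add: \<gamma>_def emeasure_distr emeasure_density measurable_space cong: nn_integral_cong)
    also have "\<dots> < \<infinity>" using W_int W_nn by (simp add: nn_integral_eq_integral)
    finally have fin: "finite_measure \<gamma>" by (intro finite_measureI) auto
    have "(\<integral>z. (case z of (x, y, l, m) \<Rightarrow> l * f x) \<partial>\<gamma>) = integral\<^sup>L u f \<and>
        (\<integral>z. (case z of (x, y, l, m) \<Rightarrow> m * f y) \<partial>\<gamma>) = integral\<^sup>L v f" if f: "continuous_on X f" for f
    proof
      obtain C where C: "0 \<le> C" "\<And>x. x \<in> X \<Longrightarrow> \<bar>f x\<bar> \<le> C" using continuous_compact_bounded[OF X f] by blast
      have fu[measurable]: "f \<in> borel_measurable u" and fv[measurable]: "f \<in> borel_measurable v"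
        using Delta_measurable u v f by auto
      have "integrable ?M (\<lambda>z. P z * f (fst z))"
      proof (rule Bochner_Integration.integrable_bound)
        show "integrable ?M (\<lambda>z. P z * C)" using int by simp
        show "AE z in ?M. norm (P z * f (fst z)) \<le> norm (P z * C)"
          using C nn by (intro AE_I2) (auto simp: abs_mult space_pair_measure space_restrict_space intro!: mult_left_mono)
      qed measurable
      note intP = this
      have "integrable ?M (\<lambda>z. Q z * f (snd z))"
      proof (rule Bochner_Integration.integrable_bound)
        show "integrable ?M (\<lambda>z. Q z * C)" using int by simp
        show "AE z in ?M. norm (Q z * f (snd z)) \<le> norm (Q z * C)"
          using C nn by (intro AE_I2) (auto simp: abs_mult space_pair_measure space_restrict_space intro!: mult_left_mono)
      qed measurable
      note intQ = this
      have "(\<integral>z. (case z of (x, y, l, m) \<Rightarrow> l * f x) \<partial>\<gamma>) = (\<integral>z. W z * (P z / W z * f (fst z)) \<partial>?M)"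
        by (subst integral)
          (auto simp: T_def Z_def split_beta intro!: continuous_intros continuous_on_compose2[OF f])
      also have "\<dots> = (\<integral>z. P z * f (fst z) \<partial>?M)" by (simp only: mult.assoc[symmetric] W_mult)
      also have "\<dots> = (\<integral>x. \<integral>y. P (x, y) * f x \<partial>v \<partial>u)" using uv.integral_fst'[OF intP] by simp
      also have "\<dots> = integral\<^sup>L u f"
        using margP by (intro integral_cong_AE) auto
      finally show "(\<integral>z. (case z of (x, y, l, m) \<Rightarrow> l * f x) \<partial>\<gamma>) = integral\<^sup>L u f" .
      have "(\<integral>z. (case z of (x, y, l, m) \<Rightarrow> m * f y) \<partial>\<gamma>) = (\<integral>z. W z * (Q z / W z * f (snd z)) \<partial>?M)"
        by (subst integral)
          (auto simp: T_def Z_def split_beta intro!: continuous_intros continuous_on_compose2[OF f])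
      also have "\<dots> = (\<integral>z. Q z * f (snd z) \<partial>?M)" by (simp only: mult.assoc[symmetric] W_mult)
      also have "\<dots> = (\<integral>y. \<integral>x. Q (x, y) * f y \<partial>u \<partial>v)"
        using uv.integral_snd[of "\<lambda>x y. Q (x, y) * f y"] intQ by (simp add: split_beta')
      also have "\<dots> = integral\<^sup>L v f"
        using margQ by (intro integral_cong_AE) auto
      finally show "(\<integral>z. (case z of (x, y, l, m) \<Rightarrow> m * f y) \<partial>\<gamma>) = integral\<^sup>L v f" .
    qed
    then show "\<gamma> \<in> M3 X u v" using fin by (auto simp: M3_def \<gamma>_def Z_def)
    have "W z * norm ((P z / W z) *\<^sub>R x - (Q z / W z) *\<^sub>R y) = norm (P z *\<^sub>R x - Q z *\<^sub>R y)" for z x y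
    proof -
      have "W z * norm ((P z / W z) *\<^sub>R x - (Q z / W z) *\<^sub>R y)
          = norm (W z *\<^sub>R ((P z / W z) *\<^sub>R x - (Q z / W z) *\<^sub>R y))" using W_nn[of z] by simp
      also have "\<dots> = norm (P z *\<^sub>R x - Q z *\<^sub>R y)"
        by (simp only: scaleR_diff_right scaleR_scaleR W_mult)
      finally show ?thesis .
    qed
    then show "(\<integral>z. (case z of (x, y, l, m) \<Rightarrow> norm (l *\<^sub>R x - m *\<^sub>R y)) \<partial>\<gamma>)
        = (\<integral>z. norm (P z *\<^sub>R fst z - Q z *\<^sub>R snd z) \<partial>?M)"
      by (subst integral)
        (auto simp: T_def split_beta intro!: continuous_intros Bochner_Integration.integral_cong)
  qed
qed

section \<open>Finite measurable partitions\<close>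

lemma
  fixes \<phi> :: "'i \<Rightarrow> real"
  assumes "finite_measure M" and F: "finite F" "\<And>x. x \<in> space M \<Longrightarrow> r x \<in> F"
    and r: "\<And>i. i \<in> F \<Longrightarrow> r -` {i} \<inter> space M \<in> sets M"
  shows integrable_finite_range: "integrable M (\<lambda>x. \<phi> (r x))"
    and integral_finite_range: "(\<integral>x. \<phi> (r x) \<partial>M) = (\<Sum>i\<in>F. measure M (r -` {i} \<inter> space M) * \<phi> i)"
proof -
  interpret finite_measure M by fact
  have eq: "\<phi> (r x) = (\<Sum>i\<in>F. indicator (r -` {i} \<inter> space M) x * \<phi> i)" if "x \<in> space M" for x
    using F that by (simp add: indicator_def if_distrib[of "\<lambda>z. z * _"] sum.delta cong: if_cong)
  have int: "integrable M (\<lambda>x. indicator (r -` {i} \<inter> space M) x * \<phi> i)" if "i \<in> F" for i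
    using r[OF that] by (simp add: integrable_real_indicator emeasure_finite less_top[symmetric])
  show "integrable M (\<lambda>x. \<phi> (r x))"
    using int by (subst Bochner_Integration.integrable_cong[OF refl eq]) auto
  show "(\<integral>x. \<phi> (r x) \<partial>M) = (\<Sum>i\<in>F. measure M (r -` {i} \<inter> space M) * \<phi> i)"
    using int r by (subst Bochner_Integration.integral_cong[OF refl eq]) (auto simp: Bochner_Integration.integral_sum)
qed

text \<open>The null fibres are finite in number, so their union is null; cells without mass can
  then be ignored almost everywhere.\<close>

lemma AE_finite_range_positive:
  assumes "finite_measure M" and F: "finite F" "\<And>x. x \<in> space M \<Longrightarrow> r x \<in> F"
    and r: "\<And>i. i \<in> F \<Longrightarrow> r -` {i} \<inter> space M \<in> sets M"
  shows "AE x in M. r x \<in> {i \<in> F. 0 < measure M (r -` {i} \<inter> space M)}"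
proof -
  interpret finite_measure M by fact
  have "AE x in M. r x = i \<longrightarrow> 0 < measure M (r -` {i} \<inter> space M)" if i: "i \<in> F" for i
  proof (cases "0 < measure M (r -` {i} \<inter> space M)")
    case False
    then have "emeasure M (r -` {i} \<inter> space M) = 0"
      using measure_nonneg[of M "r -` {i} \<inter> space M"] by (simp add: emeasure_eq_measure)
    then show ?thesis using r[OF i] by (intro AE_I[of _ _ "r -` {i} \<inter> space M"]) auto
  qed simp
  then have "AE x in M. \<forall>i\<in>F. r x = i \<longrightarrow> 0 < measure M (r -` {i} \<inter> space M)"
    using F by (intro AE_finite_allI) auto
  then show ?thesis using AE_space by eventually_elim (use F in auto)
qed

text \<open>The cells are cut from the balls of a finite net, the ball added last taking precedence.
  The centres may lie outside \<open>X\<close>; accordingly the discrete problem and the potential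
  \<open>h\<close> are posed on the ambient space.\<close>

lemma borel_finite_range_approximation:
  fixes X :: "'a::metric_space set"
  assumes "compact X" "0 < \<delta>"
  obtains r F where "finite F" "\<And>x. x \<in> X \<Longrightarrow> r x \<in> F" "\<And>x. x \<in> X \<Longrightarrow> dist x (r x) < \<delta>"
    "\<And>i. r -` {i} \<inter> X \<in> sets (restrict_space borel X)"
proof -
  \<comment> \<open>For the induction, closeness is claimed only on the part of \<open>X\<close>
    already covered, but measurability of the fibres on all of \<open>X\<close>.\<close>
  have "\<exists>r. (\<forall>x\<in>X \<inter> (\<Union>a\<in>F. ball a \<delta>). r x \<in> F \<and> dist x (r x) < \<delta>) \<and>
      (\<forall>i. r -` {i} \<inter> X \<in> sets (restrict_space borel X))" if "finite F" for F :: "'a set"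
    using that
  proof (induction F rule: finite_induct)
    case empty
    have "(\<lambda>_. undefined) -` {i} \<inter> X \<in> sets (restrict_space borel X)" for i :: 'a
      using sets.top[of "restrict_space borel X"] by (cases "i = undefined") (auto simp: space_restrict_space)
    note const = this
    show ?case by (intro exI[of _ "\<lambda>_. undefined"] conjI allI const) simp
  next
    case (insert a F)
    from insert.IH obtain r where r: "\<forall>x\<in>X \<inter> (\<Union>a\<in>F. ball a \<delta>). r x \<in> F \<and> dist x (r x) < \<delta>"
      "\<And>i. r -` {i} \<inter> X \<in> sets (restrict_space borel X)" by auto
    define B where "B = ball a \<delta>"
    define r' where "r' x = (if x \<in> B then a else r x)" for x
    have B: "X \<inter> B \<in> sets (restrict_space borel X)" by (auto simp: sets_restrict_space B_def)
    have "r' -` {i} \<inter> X \<in> sets (restrict_space borel X)" for i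
    proof -
      have "r' -` {i} \<inter> X = (if i = a then X \<inter> B else {}) \<union> (r -` {i} \<inter> X - X \<inter> B)"
        unfolding set_eq_iff r'_def by simp
      also have "\<dots> \<in> sets (restrict_space borel X)"
        using B r(2)[of i] by (intro sets.Un sets.Diff) auto
      finally show ?thesis .
    qed
    moreover have "r' x \<in> insert a F \<and> dist x (r' x) < \<delta>" if "x \<in> X \<inter> (\<Union>a\<in>insert a F. ball a \<delta>)" for x
      using that r(1) by (cases "x \<in> B") (auto simp: r'_def B_def dist_commute)
    ultimately show ?case by (intro exI[of _ r'] conjI[of "Ball _ _"] ballI allI)
  qed
  moreover obtain F where F: "finite F" "X \<subseteq> (\<Union>a\<in>F. ball a \<delta>)"
    using assms unfolding compact_eq_totally_bounded by blast
  ultimately obtain r where "\<forall>x\<in>X \<inter> (\<Union>a\<in>F. ball a \<delta>). r x \<in> F \<and> dist x (r x) < \<delta>"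
    "\<forall>i. r -` {i} \<inter> X \<in> sets (restrict_space borel X)" by blast
  then show thesis using F by (intro that[of F r]) blast+
qed

section \<open>The dual values \<open>d1\<close>, \<open>d2\<close> and
  \<open>d2plus\<close>\<close>

text \<open>Comparing a point with itself under the coefficients (1, 0) and (0, 1). The bound is
  uniform over \<open>D1 X\<close> on bounded sets, so the supremum defining \<open>d1\<close> is
  finite.\<close>

lemma abs_le_norm_D1:
  assumes "f \<in> D1 X" "x \<in> X"
  shows "\<bar>f x\<bar> \<le> norm x"
proof -
  have "a * f x - b * f x \<le> norm (a *\<^sub>R x - b *\<^sub>R x)" if "0 \<le> a" "0 \<le> b" for a b
    using assms that by (simp add: D1_def)
  from this[of 1 0] this[of 0 1] show ?thesis by simp
qed

text \<open>The coefficients a = b = 1 give a Lipschitz bound, and with it continuity.\<close>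

lemma D1_I:
  assumes "\<And>x y a b. 0 \<le> a \<Longrightarrow> 0 \<le> b \<Longrightarrow> a * h x - b * h y \<le> norm (a *\<^sub>R x - b *\<^sub>R y)"
  shows "h \<in> D1 X"
proof -
  have "h x - h y \<le> dist x y" for x y using assms[of 1 1 x y] by (simp add: dist_norm)
  then have "dist (h x) (h y) \<le> 1 * dist x y" for x y
    by (metis abs_le_iff dist_commute dist_real_def minus_diff_eq mult_1)
  then have "1-lipschitz_on X h" by (intro lipschitz_onI) auto
  then show ?thesis using assms by (auto simp: D1_def intro: lipschitz_on_continuous_on)
qed

lemma compact_norm_bound:
  fixes X :: "'a::real_normed_vector set"
  assumes "compact X"
  obtains R where "0 \<le> R" "\<And>x. x \<in> X \<Longrightarrow> norm x \<le> R"
  using continuous_compact_bounded[OF assms, of norm] by (auto intro: continuous_intros)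

context
  fixes X :: "'a::real_normed_vector set" and u v :: "'a measure"
  assumes X: "compact X" and u: "u \<in> Delta X" and v: "v \<in> Delta X"
begin

lemma bdd_above_D1: "bdd_above ((\<lambda>f. integral\<^sup>L u f - integral\<^sup>L v f) ` D1 X)"
proof -
  obtain R where R: "\<And>x. x \<in> X \<Longrightarrow> norm x \<le> R" using compact_norm_bound[OF X] by blast
  show ?thesis
  proof (rule bdd_aboveI2)
    fix f assume f: "f \<in> D1 X"
    then have cont: "continuous_on X f" by (simp add: D1_def)
    have "\<bar>f x\<bar> \<le> R" if "x \<in> X" for x using abs_le_norm_D1[OF f that] R[OF that] by simp
    then show "integral\<^sup>L u f - integral\<^sup>L v f \<le> R + R"
      using Delta_integral_le[OF X u cont, of R] Delta_integral_le[OF X v continuous_on_minus[OF cont], of R]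
      by (force simp: abs_le_iff)
  qed
qed

lemma bdd_above_D2eps: "bdd_above ((\<lambda>(f, g). integral\<^sup>L u f + integral\<^sup>L v g) ` D2eps X \<epsilon>)"
proof -
  obtain R where R: "\<And>x. x \<in> X \<Longrightarrow> norm x \<le> R" using compact_norm_bound[OF X] by blast
  show ?thesis
  proof (rule bdd_aboveI2, clarify)
    fix f g assume fg: "(f, g) \<in> D2eps X \<epsilon>"
    have "a * f x + b * g x \<le> \<epsilon> + norm (a *\<^sub>R x - b *\<^sub>R x)" if "x \<in> X" "a \<in> {0..1}" "b \<in> {0..1}" for x a b
      using fg that by (simp add: D2eps_def)
    \<comment> \<open>Only upper bounds on \<open>f\<close> and \<open>g\<close> come out, which is
      enough for the supremum.\<close>
    from this[of _ 1 0] this[of _ 0 1] have "f x \<le> \<epsilon> + R" "g x \<le> \<epsilon> + R" if "x \<in> X" for x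
      using that R[OF that] by fastforce+
    then show "integral\<^sup>L u f + integral\<^sup>L v g \<le> (\<epsilon> + R) + (\<epsilon> + R)"
      using fg by (intro add_mono Delta_integral_le[OF X] u v) (auto simp: D2eps_def)
  qed
qed

lemma D2_subset_D2eps: "0 \<le> \<epsilon> \<Longrightarrow> D2 X \<subseteq> D2eps X \<epsilon>"
  by (force simp: D2_def D2eps_def)

lemma zero_in_D2: "(\<lambda>_. 0, \<lambda>_. 0) \<in> D2 X"
  by (simp add: D2_def)

lemma d2_le_d2eps: "0 \<le> \<epsilon> \<Longrightarrow> d2 X u v \<le> d2eps X \<epsilon> u v"
  unfolding d2_def d2eps_def
  using zero_in_D2 by (intro cSUP_subset_mono bdd_above_D2eps D2_subset_D2eps) auto

lemma d2_le_d2plus: "d2 X u v \<le> d2plus X u v"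
  unfolding d2plus_def by (intro cINF_greatest d2_le_d2eps) auto

lemma d1_eq_d2: "d1 X u v = d2 X u v"
proof (rule antisym)
  \<comment> \<open>\<open>D2 X\<close> is contained in \<open>D2eps X 0\<close>, so it inherits the
    bound at \<epsilon> = 0.\<close>
  have bdd2: "bdd_above ((\<lambda>(f, g). integral\<^sup>L u f + integral\<^sup>L v g) ` D2 X)"
    using bdd_above_mono[OF bdd_above_D2eps[of 0] image_mono[OF D2_subset_D2eps]] by simp
  show "d1 X u v \<le> d2 X u v"
    unfolding d1_def
  proof (rule cSUP_least)
    show "D1 X \<noteq> {}" by (auto simp: D1_def intro!: exI[of _ "\<lambda>_. 0"])
    fix f assume f: "f \<in> D1 X"
    then have "(f, \<lambda>x. - f x) \<in> D2 X" by (auto simp: D1_def D2_def intro: continuous_intros)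
    from cSUP_upper[OF this bdd2] show "integral\<^sup>L u f - integral\<^sup>L v f \<le> d2 X u v"
      by (simp add: d2_def)
  qed
  show "d2 X u v \<le> d1 X u v"
    unfolding d2_def
  proof (rule cSUP_least)
    show "D2 X \<noteq> {}" using zero_in_D2 by auto
    fix fg assume "fg \<in> D2 X"
    then obtain f g where fg: "fg = (f, g)" "continuous_on X f" "continuous_on X g"
      "\<And>x y a b. x \<in> X \<Longrightarrow> y \<in> X \<Longrightarrow> 0 \<le> a \<Longrightarrow> 0 \<le> b \<Longrightarrow> a * f x + b * g y \<le> norm (a *\<^sub>R x - b *\<^sub>R y)"
      by (auto simp: D2_def)
    \<comment> \<open>With both index sets equal to \<open>X\<close>, exchanging
      \<open>(f, g)\<close> for \<open>(h, -h)\<close> can only increase the value.\<close>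
    obtain h where h: "\<And>x y a b. 0 \<le> a \<Longrightarrow> 0 \<le> b \<Longrightarrow> a * h x - b * h y \<le> norm (a *\<^sub>R x - b *\<^sub>R y)"
      "\<And>x. x \<in> X \<Longrightarrow> f x \<le> h x" "\<And>x. x \<in> X \<Longrightarrow> g x \<le> - h x"
      using homogeneous_potential[OF Delta_nonempty[OF u] Delta_nonempty[OF u] fg(4)] by blast
    have hD: "h \<in> D1 X" using h(1) by (rule D1_I)
    then have cont: "continuous_on X h" by (simp add: D1_def)
    have "integral\<^sup>L u f \<le> integral\<^sup>L u h"
      using h Delta_space[OF u] by (intro integral_mono Delta_integrable[OF X u] fg cont) auto
    moreover have "integral\<^sup>L v g \<le> (\<integral>x. - h x \<partial>v)"
      using h Delta_space[OF v] by (intro integral_mono Delta_integrable[OF X v] fg cont continuous_intros) auto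
    ultimately show "(case fg of (f, g) \<Rightarrow> integral\<^sup>L u f + integral\<^sup>L v g) \<le> d1 X u v"
      using cSUP_upper[OF hD bdd_above_D1] by (simp add: fg d1_def)
  qed
qed

section \<open>Weak duality\<close>

lemma bdd_below_M3:
  "bdd_below ((\<lambda>\<gamma>. \<integral>z. (case z of (x, y, l, m) \<Rightarrow> norm (l *\<^sub>R x - m *\<^sub>R y)) \<partial>\<gamma>) ` M3 X u v)"
  by (intro bdd_belowI2[of _ 0] Bochner_Integration.integral_nonneg) auto

text \<open>The constraint of \<open>D2eps\<close> holds at every point of the support space,
  because its last two coordinates lie in [0,1]. Integrating it costs \<epsilon> times the total
  mass of \<gamma>, which is finite, so the error vanishes as \<epsilon> tends to 0.\<close>

lemma d2plus_le_cost:
  assumes \<gamma>: "\<gamma> \<in> M3 X u v"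
  shows "d2plus X u v \<le> (\<integral>z. (case z of (x, y, l, m) \<Rightarrow> norm (l *\<^sub>R x - m *\<^sub>R y)) \<partial>\<gamma>)" (is "_ \<le> ?c")
proof -
  define Z where "Z = X \<times> X \<times> {0..1::real} \<times> {0..1::real}"
  interpret finite_measure \<gamma> using \<gamma> by (simp add: M3_def)
  have sets: "sets \<gamma> = sets (restrict_space borel Z)" using \<gamma> by (simp add: M3_def Z_def)
  have space: "space \<gamma> = Z" using sets_eq_imp_space_eq[OF sets] by (simp add: space_restrict_space)
  have int: "integrable \<gamma> \<phi>" if \<phi>: "continuous_on Z \<phi>" for \<phi> :: "_ \<Rightarrow> real"
  proof -
    have "compact Z" unfolding Z_def by (intro compact_Times X compact_Icc)
    then obtain C where "\<And>z. z \<in> Z \<Longrightarrow> \<bar>\<phi> z\<bar> \<le> C" using continuous_compact_bounded[OF _ \<phi>] by blast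
    moreover have "\<phi> \<in> borel_measurable \<gamma>"
      using borel_measurable_continuous_on_restrict[OF \<phi>] measurable_cong_sets[OF sets refl] by blast
    ultimately show ?thesis using space by (intro integrable_const_bound[of _ C]) auto
  qed
  have cost: "continuous_on Z (\<lambda>(x, y, l, m). norm (l *\<^sub>R x - m *\<^sub>R y))"
    by (auto simp: split_beta intro!: continuous_intros)
  have le: "d2eps X \<epsilon> u v \<le> \<epsilon> * measure \<gamma> (space \<gamma>) + ?c" if "0 < \<epsilon>" for \<epsilon>
    unfolding d2eps_def
  proof (rule cSUP_least)
    show "D2eps X \<epsilon> \<noteq> {}" using zero_in_D2 D2_subset_D2eps[of \<epsilon>] that by auto
    fix fg assume "fg \<in> D2eps X \<epsilon>"
    then obtain f g where fg: "fg = (f, g)" "continuous_on X f" "continuous_on X g"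
      "\<And>x y a b. x \<in> X \<Longrightarrow> y \<in> X \<Longrightarrow> a \<in> {0..1} \<Longrightarrow> b \<in> {0..1} \<Longrightarrow> a * f x + b * g y \<le> \<epsilon> + norm (a *\<^sub>R x - b *\<^sub>R y)"
      by (auto simp: D2eps_def)
    have F: "continuous_on Z (\<lambda>(x, y, l, m). l * f x)"
      by (auto simp: Z_def split_beta intro!: continuous_intros continuous_on_compose2[OF fg(2)])
    have G: "continuous_on Z (\<lambda>(x, y, l, m). m * g y)"
      by (auto simp: Z_def split_beta intro!: continuous_intros continuous_on_compose2[OF fg(3)])
    have "integral\<^sup>L u f + integral\<^sup>L v g
        = (\<integral>z. (case z of (x, y, l, m) \<Rightarrow> l * f x) \<partial>\<gamma>) + (\<integral>z. (case z of (x, y, l, m) \<Rightarrow> m * g y) \<partial>\<gamma>)"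
      using \<gamma> fg by (simp add: M3_def)
    also have "\<dots> = (\<integral>z. (case z of (x, y, l, m) \<Rightarrow> l * f x) + (case z of (x, y, l, m) \<Rightarrow> m * g y) \<partial>\<gamma>)"
      using int[OF F] int[OF G] by simp
    also have "\<dots> \<le> (\<integral>z. \<epsilon> + (case z of (x, y, l, m) \<Rightarrow> norm (l *\<^sub>R x - m *\<^sub>R y)) \<partial>\<gamma>)"
      using int[OF F] int[OF G] int[OF cost] fg(4) space
      by (intro integral_mono) (auto simp: Z_def)
    also have "\<dots> = \<epsilon> * measure \<gamma> (space \<gamma>) + ?c" using int[OF cost] by simp
    finally show "(case fg of (f, g) \<Rightarrow> integral\<^sup>L u f + integral\<^sup>L v g) \<le> \<epsilon> * measure \<gamma> (space \<gamma>) + ?c"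
      by (simp add: fg)
  qed
  show ?thesis
  proof (rule field_le_epsilon)
    fix e :: real assume e: "0 < e"
    \<comment> \<open>Adding 1 makes the denominator positive whatever the mass.\<close>
    define \<epsilon> where "\<epsilon> = e / (measure \<gamma> (space \<gamma>) + 1)"
    have \<epsilon>: "0 < \<epsilon>" using e by (simp add: \<epsilon>_def add_nonneg_pos)
    have "bdd_below ((\<lambda>\<epsilon>. d2eps X \<epsilon> u v) ` {0<..})"
      using d2_le_d2eps by (intro bdd_belowI2[of _ "d2 X u v"]) auto
    then have "d2plus X u v \<le> d2eps X \<epsilon> u v" unfolding d2plus_def using \<epsilon> by (intro cINF_lower) auto
    also have "\<dots> \<le> \<epsilon> * measure \<gamma> (space \<gamma>) + ?c" by (rule le[OF \<epsilon>])
    also have "\<epsilon> * measure \<gamma> (space \<gamma>) \<le> \<epsilon> * (measure \<gamma> (space \<gamma>) + 1)" using \<epsilon> by simp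
    also have "\<dots> = e" unfolding \<epsilon>_def using measure_nonneg[of \<gamma> "space \<gamma>"]
      by (simp add: add_nonneg_eq_0_iff)
    finally show "d2plus X u v \<le> ?c + e" by simp
  qed
qed

section \<open>Near-optimal plans by discretisation\<close>

text \<open>
  The optimal plan between the discretised measures is spread over the cells of the partition by
  the product measure, which restores the marginals \<open>u\<close> and \<open>v\<close> exactly.
\<close>
lemma near_optimal_plan:
  assumes \<delta>: "0 < \<delta>" and \<eta>: "0 < \<eta>"
  obtains \<gamma> where "\<gamma> \<in> M3 X u v"
    "(\<integral>z. (case z of (x, y, l, m) \<Rightarrow> norm (l *\<^sub>R x - m *\<^sub>R y)) \<partial>\<gamma>) \<le> d1 X u v + 4 * \<delta> + \<eta>"
proof -
  interpret u: prob_space u by (rule Delta_prob_space) (rule u)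
  interpret v: prob_space v by (rule Delta_prob_space) (rule v)
  interpret uv: pair_prob_space u v ..
  note space = Delta_space[OF u] Delta_space[OF v]
  obtain r F where F: "finite F" and rF: "\<And>x. x \<in> X \<Longrightarrow> r x \<in> F" and r_dist: "\<And>x. x \<in> X \<Longrightarrow> dist x (r x) < \<delta>"
    and r_sets: "\<And>i. r -` {i} \<inter> X \<in> sets (restrict_space borel X)"
    using borel_finite_range_approximation[OF X \<delta>] by metis
  have ru: "r -` {i} \<inter> space u \<in> sets u" and rv: "r -` {i} \<inter> space v \<in> sets v" for i
    using r_sets Delta_sets[OF u] Delta_sets[OF v] space by auto
  define s where "s i = measure u (r -` {i} \<inter> space u)" for i
  define t where "t i = measure v (r -` {i} \<inter> space v)" for i
  have s0: "0 \<le> s i" and t0: "0 \<le> t i" for i by (simp_all add: s_def t_def)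
  have int_u: "integrable u (\<lambda>x. \<phi> (r x))" "(\<integral>x. \<phi> (r x) \<partial>u) = (\<Sum>i\<in>F. s i * \<phi> i)" for \<phi> :: "'a \<Rightarrow> real"
    unfolding s_def using integrable_finite_range[OF u.finite_measure_axioms F, of r]
      integral_finite_range[OF u.finite_measure_axioms F, of r] rF ru space by auto
  have int_v: "integrable v (\<lambda>x. \<phi> (r x))" "(\<integral>x. \<phi> (r x) \<partial>v) = (\<Sum>i\<in>F. t i * \<phi> i)" for \<phi> :: "'a \<Rightarrow> real"
    unfolding t_def using integrable_finite_range[OF v.finite_measure_axioms F, of r]
      integral_finite_range[OF v.finite_measure_axioms F, of r] rF rv space by auto
  have int_uv: "integrable (u \<Otimes>\<^sub>M v) (\<lambda>z. \<phi> (r (fst z)) (r (snd z)))"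
    "(\<integral>z. \<phi> (r (fst z)) (r (snd z)) \<partial>(u \<Otimes>\<^sub>M v)) = (\<Sum>i\<in>F. \<Sum>j\<in>F. s i * t j * \<phi> i j)" for \<phi> :: "'a \<Rightarrow> 'a \<Rightarrow> real"
  proof -
    define r2 where "r2 z = (r (fst z), r (snd z))" for z
    have vim: "r2 -` {(i, j)} \<inter> space (u \<Otimes>\<^sub>M v) = (r -` {i} \<inter> space u) \<times> (r -` {j} \<inter> space v)" for i j
      by (auto simp: r2_def space_pair_measure)
    then have meas: "measure (u \<Otimes>\<^sub>M v) (r2 -` {(i, j)} \<inter> space (u \<Otimes>\<^sub>M v)) = s i * t j" for i j
      using ru rv by (simp add: s_def t_def measure_def v.emeasure_pair_measure_Times enn2real_mult)
    have r2: "finite (F \<times> F)" "\<And>z. z \<in> space (u \<Otimes>\<^sub>M v) \<Longrightarrow> r2 z \<in> F \<times> F"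
      "\<And>k. k \<in> F \<times> F \<Longrightarrow> r2 -` {k} \<inter> space (u \<Otimes>\<^sub>M v) \<in> sets (u \<Otimes>\<^sub>M v)"
      using F rF space vim ru rv by (auto simp: r2_def space_pair_measure)
    show "integrable (u \<Otimes>\<^sub>M v) (\<lambda>z. \<phi> (r (fst z)) (r (snd z)))"
      using integrable_finite_range[OF uv.finite_measure_axioms r2, of "case_prod \<phi>"] by (simp add: r2_def)
    show "(\<integral>z. \<phi> (r (fst z)) (r (snd z)) \<partial>(u \<Otimes>\<^sub>M v)) = (\<Sum>i\<in>F. \<Sum>j\<in>F. s i * t j * \<phi> i j)"
    proof -
      have "(\<integral>z. case_prod \<phi> (r2 z) \<partial>(u \<Otimes>\<^sub>M v)) = (\<Sum>(i, j)\<in>F \<times> F. s i * t j * \<phi> i j)"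
        by (subst integral_finite_range[OF uv.finite_measure_axioms r2])
          (auto simp: meas intro!: sum.cong)
      then show ?thesis by (simp add: r2_def sum.cartesian_product)
    qed
  qed
  \<comment> \<open>Only cells with positive mass are kept, so that dividing by \<open>s i\<close>
    and \<open>t j\<close> is meaningful; the dropped terms have weight zero in every sum.\<close>
  define I where "I = {i \<in> F. 0 < s i}"
  define J where "J = {j \<in> F. 0 < t j}"
  have sumI: "(\<Sum>i\<in>F. s i * \<phi> i) = (\<Sum>i\<in>I. s i * \<phi> i)" for \<phi> :: "'a \<Rightarrow> real"
    using F s0 by (intro sum.mono_neutral_right) (auto simp: I_def order.order_iff_strict)
  have sumJ: "(\<Sum>j\<in>F. t j * \<phi> j) = (\<Sum>j\<in>J. t j * \<phi> j)" for \<phi> :: "'a \<Rightarrow> real"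
    using F t0 by (intro sum.mono_neutral_right) (auto simp: J_def order.order_iff_strict)
  have s1: "(\<Sum>i\<in>I. s i) = 1" using int_u(2)[of "\<lambda>_. 1"] sumI[of "\<lambda>_. 1"] u.prob_space by simp
  have t1: "(\<Sum>j\<in>J. t j) = 1" using int_v(2)[of "\<lambda>_. 1"] sumJ[of "\<lambda>_. 1"] v.prob_space by simp
  have I: "finite I" "I \<noteq> {}"
    using F s1 by (simp add: I_def, metis sum.empty zero_neq_one)
  have J: "finite J" "J \<noteq> {}"
    using F t1 by (simp add: J_def, metis sum.empty zero_neq_one)
  obtain p q f g where pq0: "\<And>i j. 0 \<le> p i j" "\<And>i j. 0 \<le> q i j"
    and p: "\<And>i. i \<in> I \<Longrightarrow> (\<Sum>j\<in>J. p i j) = s i" and q: "\<And>j. j \<in> J \<Longrightarrow> (\<Sum>i\<in>I. q i j) = t j"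
    and fg: "\<And>i j a b. i \<in> I \<Longrightarrow> j \<in> J \<Longrightarrow> 0 \<le> a \<Longrightarrow> 0 \<le> b \<Longrightarrow> a * f i + b * g j \<le> norm (a *\<^sub>R i - b *\<^sub>R j)"
    and dual: "(\<Sum>i\<in>I. \<Sum>j\<in>J. norm (p i j *\<^sub>R i - q i j *\<^sub>R j)) \<le> (\<Sum>i\<in>I. s i * f i) + (\<Sum>j\<in>J. t j * g j) + \<eta>"
    by (rule finite_duality[OF I J s0 t0 \<eta>]) (rule that)
  obtain h where h: "\<And>x y a b. 0 \<le> a \<Longrightarrow> 0 \<le> b \<Longrightarrow> a * h x - b * h y \<le> norm (a *\<^sub>R x - b *\<^sub>R y)"
    "\<And>i. i \<in> I \<Longrightarrow> f i \<le> h i" "\<And>j. j \<in> J \<Longrightarrow> g j \<le> - h j"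
    using homogeneous_potential[OF I(2) J(2) fg] by blast
  have hD: "h \<in> D1 X" using h(1) by (rule D1_I)
  then have cont: "continuous_on X h" by (simp add: D1_def)
  \<comment> \<open>With a = b = 1, \<open>h\<close> is 1-Lipschitz on the ambient space, hence also
    between a point of \<open>X\<close> and its centre.\<close>
  have h_near: "h (r x) \<le> h x + \<delta>" "h x \<le> h (r x) + \<delta>" if "x \<in> X" for x
    using h(1)[of 1 1 "r x" x] h(1)[of 1 1 x "r x"] r_dist[OF that] by (auto simp: dist_norm norm_minus_commute)
  \<comment> \<open>Replacing \<open>f\<close> and \<open>g\<close> by \<open>h\<close> and
    \<open>- h\<close> raises the dual value; returning from centres to points then costs \<delta>
    for each marginal. This is the first 2 \<delta> of the final error.\<close>
  have "(\<Sum>i\<in>I. s i * f i) \<le> (\<Sum>i\<in>I. s i * h i)"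
    using h(2) s0 by (intro sum_mono mult_left_mono) auto
  also have "\<dots> = (\<integral>x. h (r x) \<partial>u)" by (simp add: int_u(2) sumI)
  also have "\<dots> \<le> (\<integral>x. h x + \<delta> \<partial>u)"
    using int_u(1) Delta_integrable[OF X u cont] h_near space by (intro integral_mono) auto
  also have "\<dots> = integral\<^sup>L u h + \<delta>" using Delta_integrable[OF X u cont] u.prob_space by simp
  finally have dual_u: "(\<Sum>i\<in>I. s i * f i) \<le> integral\<^sup>L u h + \<delta>" .
  have "(\<Sum>j\<in>J. t j * g j) \<le> (\<Sum>j\<in>J. t j * (- h j))"
    using h(3) t0 by (intro sum_mono mult_left_mono) auto
  also have "\<dots> = (\<integral>x. - h (r x) \<partial>v)" using int_v(2)[of "\<lambda>x. - h x"] sumJ[of "\<lambda>x. - h x"] by simp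
  also have "\<dots> \<le> (\<integral>x. \<delta> - h x \<partial>v)"
    using int_v(1) Delta_integrable[OF X v cont] h_near space by (intro integral_mono) (auto simp: algebra_simps)
  also have "\<dots> = \<delta> - integral\<^sup>L v h" using Delta_integrable[OF X v cont] v.prob_space by simp
  finally have dual_v: "(\<Sum>j\<in>J. t j * g j) \<le> \<delta> - integral\<^sup>L v h" .
  have "integral\<^sup>L u h - integral\<^sup>L v h \<le> d1 X u v"
    unfolding d1_def by (rule cSUP_upper[OF hD bdd_above_D1])
  with dual dual_u dual_v
  have finite_cost: "(\<Sum>i\<in>I. \<Sum>j\<in>J. norm (p i j *\<^sub>R i - q i j *\<^sub>R j)) \<le> d1 X u v + 2 * \<delta> + \<eta>" by simp

  \<comment> \<open>Cells of measure zero get density zero, by \<open>x / 0 = 0\<close>.\<close>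
  define P where "P i j = p i j / (s i * t j)" for i j
  define Q where "Q i j = q i j / (s i * t j)" for i j
  have P0: "0 \<le> P i j" and Q0: "0 \<le> Q i j" for i j using pq0 s0 t0 by (auto simp: P_def Q_def)
  have sum_cells: "(\<Sum>i\<in>F. \<Sum>j\<in>F. s i * t j * \<phi> i j) = (\<Sum>i\<in>I. \<Sum>j\<in>J. s i * t j * \<phi> i j)" for \<phi> :: "'a \<Rightarrow> 'a \<Rightarrow> real"
    by (simp only: mult.assoc sum_distrib_left[symmetric] sumI sumJ)
  have st_P: "s i * t j * P i j = p i j" and st_Q: "s i * t j * Q i j = q i j" if "i \<in> I" "j \<in> J" for i j
    using that by (auto simp: P_def Q_def I_def J_def)
  have AE_u: "AE x in u. r x \<in> I"
    unfolding I_def s_def using rF ru space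
    by (intro AE_finite_range_positive[OF u.finite_measure_axioms F]) auto
  have AE_v: "AE x in v. r x \<in> J"
    unfolding J_def t_def using rF rv space
    by (intro AE_finite_range_positive[OF v.finite_measure_axioms F]) auto
  \<comment> \<open>The density is constant on cells, so its integral over \<open>v\<close> is a row
    sum of \<open>p\<close> divided by \<open>s i\<close>. The value 1 makes the first marginal
    \<open>u\<close> itself and not its discretisation.\<close>
  have margP: "(\<integral>y. P i (r y) \<partial>v) = 1" if "i \<in> I" for i
  proof -
    have "(\<integral>y. P i (r y) \<partial>v) = (\<Sum>j\<in>J. t j * P i j)" by (simp add: int_v(2) sumJ)
    also have "\<dots> = (\<Sum>j\<in>J. p i j) / s i"
      unfolding sum_divide_distrib by (intro sum.cong) (auto simp: P_def J_def)
    finally show ?thesis using p[OF that] that by (simp add: I_def)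
  qed
  have margQ: "(\<integral>x. Q (r x) j \<partial>u) = 1" if "j \<in> J" for j
  proof -
    have "(\<integral>x. Q (r x) j \<partial>u) = (\<Sum>i\<in>I. s i * Q i j)" by (simp add: int_u(2)[of "\<lambda>i. Q i j"] sumI)
    also have "\<dots> = (\<Sum>i\<in>I. q i j) / t j"
      unfolding sum_divide_distrib by (intro sum.cong) (auto simp: Q_def I_def)
    finally show ?thesis using q[OF that] that by (simp add: J_def)
  qed
  define P' where "P' z = P (r (fst z)) (r (snd z))" for z
  define Q' where "Q' z = Q (r (fst z)) (r (snd z))" for z
  obtain \<gamma> where \<gamma>: "\<gamma> \<in> M3 X u v"
    "(\<integral>z. (case z of (x, y, l, m) \<Rightarrow> norm (l *\<^sub>R x - m *\<^sub>R y)) \<partial>\<gamma>)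
      = (\<integral>z. norm (P' z *\<^sub>R fst z - Q' z *\<^sub>R snd z) \<partial>(u \<Otimes>\<^sub>M v))"
  proof (rule M3_from_densities[OF X u v])
    show "integrable (u \<Otimes>\<^sub>M v) P'" "integrable (u \<Otimes>\<^sub>M v) Q'"
      unfolding P'_def Q'_def by (rule int_uv(1))+
    show "0 \<le> P' z" "0 \<le> Q' z" for z using P0 Q0 by (auto simp: P'_def Q'_def)
    show "AE x in u. (\<integral>y. P' (x, y) \<partial>v) = 1" using AE_u by eventually_elim (simp add: P'_def margP)
    show "AE y in v. (\<integral>x. Q' (x, y) \<partial>u) = 1" using AE_v by eventually_elim (simp add: Q'_def margQ)
  qed (rule that)
  \<comment> \<open>A bound depending on the cells only: moving both points to their centres costs
    \<delta> times each coefficient. Both densities have total integral 1, whence the other 2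
    \<delta>.\<close>
  define \<phi> where "\<phi> i j = norm (P i j *\<^sub>R i - Q i j *\<^sub>R j) + \<delta> * P i j + \<delta> * Q i j" for i j
  have "norm (P' z *\<^sub>R fst z - Q' z *\<^sub>R snd z) \<le> \<phi> (r (fst z)) (r (snd z))" if z: "z \<in> space (u \<Otimes>\<^sub>M v)" for z
  proof -
    have zX: "fst z \<in> X" "snd z \<in> X" using z by (simp_all add: space_pair_measure space mem_Times_iff)
    have "P' z *\<^sub>R fst z - Q' z *\<^sub>R snd z = (P' z *\<^sub>R r (fst z) - Q' z *\<^sub>R r (snd z))
        + P' z *\<^sub>R (fst z - r (fst z)) - Q' z *\<^sub>R (snd z - r (snd z))"
      by (simp add: scaleR_diff_right)
    also have "norm \<dots> \<le> norm (P' z *\<^sub>R r (fst z) - Q' z *\<^sub>R r (snd z))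
        + norm (P' z *\<^sub>R (fst z - r (fst z))) + norm (Q' z *\<^sub>R (snd z - r (snd z)))"
      by (meson add_right_mono norm_triangle_ineq norm_triangle_ineq4 order_trans)
    also have "\<dots> \<le> norm (P' z *\<^sub>R r (fst z) - Q' z *\<^sub>R r (snd z)) + \<delta> * P' z + \<delta> * Q' z"
      using r_dist[OF zX(1)] r_dist[OF zX(2)] P0 Q0
      by (intro add_mono) (auto simp: dist_norm P'_def Q'_def mult.commute[of \<delta>] intro!: mult_left_mono)
    finally show ?thesis by (simp add: \<phi>_def P'_def Q'_def)
  qed
  then have "(\<integral>z. norm (P' z *\<^sub>R fst z - Q' z *\<^sub>R snd z) \<partial>(u \<Otimes>\<^sub>M v)) \<le> (\<integral>z. \<phi> (r (fst z)) (r (snd z)) \<partial>(u \<Otimes>\<^sub>M v))"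
    using int_uv(1) P0 Q0 \<delta> by (intro integral_mono') (auto simp: \<phi>_def)
  also have "\<dots> = (\<Sum>i\<in>I. \<Sum>j\<in>J. s i * t j * \<phi> i j)" by (simp only: int_uv(2) sum_cells)
  also have "\<dots> = (\<Sum>i\<in>I. \<Sum>j\<in>J. norm (p i j *\<^sub>R i - q i j *\<^sub>R j) + \<delta> * p i j + \<delta> * q i j)"
  proof (intro sum.cong refl)
    fix i j assume ij: "i \<in> I" "j \<in> J"
    \<comment> \<open>Homogeneity of the norm absorbs the mass of the product cell and returns the
      discrete cost.\<close>
    have "s i * t j * norm (P i j *\<^sub>R i - Q i j *\<^sub>R j) = norm ((s i * t j) *\<^sub>R (P i j *\<^sub>R i - Q i j *\<^sub>R j))"
      using s0 t0 by simp
    also have "\<dots> = norm (p i j *\<^sub>R i - q i j *\<^sub>R j)"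
      by (simp only: scaleR_diff_right scaleR_scaleR st_P[OF ij] st_Q[OF ij])
    finally show "s i * t j * \<phi> i j = norm (p i j *\<^sub>R i - q i j *\<^sub>R j) + \<delta> * p i j + \<delta> * q i j"
      unfolding \<phi>_def st_P[OF ij, symmetric] st_Q[OF ij, symmetric] by (simp add: algebra_simps)
  qed
  also have "\<dots> = (\<Sum>i\<in>I. \<Sum>j\<in>J. norm (p i j *\<^sub>R i - q i j *\<^sub>R j))
      + \<delta> * (\<Sum>i\<in>I. \<Sum>j\<in>J. p i j) + \<delta> * (\<Sum>i\<in>I. \<Sum>j\<in>J. q i j)"
    by (simp add: sum.distrib sum_distrib_left)
  also have "(\<Sum>i\<in>I. \<Sum>j\<in>J. p i j) = 1" using p s1 by simp
  also have "(\<Sum>i\<in>I. \<Sum>j\<in>J. q i j) = 1" using q t1 by (subst sum.swap) simp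
  finally show thesis using finite_cost \<gamma> by (intro that[of \<gamma>]) auto
qed

section \<open>Closing the chain of inequalities\<close>

lemma d2plus_le_d3: "d2plus X u v \<le> d3 X u v"
proof -
  \<comment> \<open>Any tolerances will do here. Non-emptiness is what makes the real infimum
    \<open>d3\<close> a greatest lower bound.\<close>
  have "M3 X u v \<noteq> {}" using near_optimal_plan[of 1 1] by force
  then show ?thesis unfolding d3_def by (intro cINF_greatest d2plus_le_cost)
qed

lemma d3_le_d1: "d3 X u v \<le> d1 X u v"
proof (rule field_le_epsilon)
  fix e :: real assume e: "0 < e"
  \<comment> \<open>The tolerances add up to \<open>e\<close>, as 4 (e / 8) + e / 2 = e.\<close>
  obtain \<gamma> where "\<gamma> \<in> M3 X u v"
    "(\<integral>z. (case z of (x, y, l, m) \<Rightarrow> norm (l *\<^sub>R x - m *\<^sub>R y)) \<partial>\<gamma>) \<le> d1 X u v + 4 * (e / 8) + e / 2"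
    using near_optimal_plan[of "e / 8" "e / 2"] e by auto
  then show "d3 X u v \<le> d1 X u v + e"
    unfolding d3_def using cINF_lower[OF bdd_below_M3, of \<gamma>] by auto
qed

end

text \<open>The cycle d1 = d2 <= d2plus <= d3 <= d1 forces equality throughout.\<close>

theorem theorem1:
  fixes X :: "'a::real_normed_vector set" and u v :: "'a measure"
  assumes "compact X" and "u \<in> Delta X" and "v \<in> Delta X"
  shows "d1 X u v = d2 X u v \<and> d2 X u v = d2plus X u v \<and> d2plus X u v = d3 X u v"
  using d1_eq_d2[OF assms] d2_le_d2plus[OF assms] d2plus_le_d3[OF assms] d3_le_d1[OF assms] by auto

end
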